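(* The following identity holds for $\Re(x)>-\frac12$: $$\lim_{N\to\infty}\prod_{k=1}^{2N}\left(1-\frac{4x^2}{k^2}\right)^{-k^2(-1)^k}=\frac{\cos(\pi x)}{\pi}\exp\!\left(2x^2+\frac{7\zeta(3)}{2\pi^2}\right)\bigl(G(1+x)\,G(1-x)\bigr)^4\left(\frac{\Gamma_3\!\left(\frac32-x\right)\Gamma_3\!\left(\frac32+x\right)}{\Gamma_3(1-x)\,\Gamma_3(1+x)}\right)^8 .$$
   Context: $\zeta$ is the Riemann zeta function. $\Gamma_n$ is the multiple gamma function, defined as a generalization of the Euler gamma function $\Gamma$ by the recurrence-functional equation $\Gamma_{n+1}(z+1)=\Gamma_{n+1}(z)/\Gamma_n(z)$ for $z\in\mathbb{C}$, $n\in\mathbb{N}$, with $\Gamma_1(z)=\Gamma(z)$ and $\Gamma_n(1)=1$; $\Gamma_3$ is the case $n=3$ (triple gamma function). $G(z)=1/\Gamma_2(z)$ is the Barnes function, satisfying $G(z+1)=G(z)\,\Gamma(z)$ and $G(1)=1$.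
   Formalization: The quotient of Γ_3 values is inverted (Γ_3(1∓x) in the numerator, Γ_3(3/2∓x) in the denominator), since the printed form fails at x=0; Γ_n is fixed by the Dufresnoy–Pisot/Vignéras sign condition, and at positive integers x, where both sides have poles, both are read as 0. *)

theory Defs
  imports "HOL-Complex_Analysis.Complex_Analysis"
begin

(* The Dirichlet series; it is the Riemann zeta function on the half-plane Re s > 1 only. *)
definition zeta :: "complex \<Rightarrow> complex" where
  "zeta s = (\<Sum>k. 1 / of_nat (Suc k) powr s)"

(* The recurrence and the normalisation leave Gamma_n undetermined up to periodic factors.
   As in the Bohr-Mollerup theorem (n = 1), the standard extra condition, due to
   Dufresnoy-Pisot and Vigneras, is that Gamma_n is smooth and positive on the positive
   reals with (-1)^(n+1) (d/dx)^(n+1) ln Gamma_n(x) >= 0 there; exactly one family satisfies it.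
   Each Gamma_n is holomorphic off the nonpositive integers, where it has poles;
   there it takes the value 0, which is the convention of the constant Gamma.
   The index n = 0 is unused. *)
definition multiple_Gamma_family :: "(nat \<Rightarrow> complex \<Rightarrow> complex) \<Rightarrow> bool" where
  "multiple_Gamma_family \<Gamma> \<longleftrightarrow>
     \<Gamma> 1 = Gamma \<and>
     (\<forall>n\<ge>1.
        \<Gamma> n 1 = 1 \<and>
        (\<forall>z. z \<notin> \<int>\<^sub>\<le>\<^sub>0 \<longrightarrow> \<Gamma> (Suc n) (z + 1) = \<Gamma> (Suc n) z / \<Gamma> n z) \<and>
        \<Gamma> n holomorphic_on (- \<int>\<^sub>\<le>\<^sub>0) \<and>
        (\<forall>z\<in>\<int>\<^sub>\<le>\<^sub>0. \<Gamma> n z = 0) \<and>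
        (\<forall>x::real. x > 0 \<longrightarrow> \<Gamma> n (of_real x) \<in> \<real> \<and> Re (\<Gamma> n (of_real x)) > 0) \<and>
        (\<forall>x::real. x > 0 \<longrightarrow>
           (-1) ^ (n + 1) * (deriv ^^ (n + 1)) (\<lambda>t::real. ln (Re (\<Gamma> n (of_real t)))) x \<ge> 0))"

(* The Barnes function G = 1 / Gamma_2. It is entire; as 1 / 0 = 0, its zeros at the
   nonpositive integers come out correctly. *)
definition Barnes_G :: "(nat \<Rightarrow> complex \<Rightarrow> complex) \<Rightarrow> complex \<Rightarrow> complex" where
  "Barnes_G \<Gamma> z = 1 / \<Gamma> 2 z"

(* Orientation of the Gamma_3 quotient in the product formula: with the recurrence above,
   Gamma_3 is holomorphic and nonzero off the nonpositive integers and has a pole of order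
   (m+1)(m+2)/2 at -m. The limit of prod_{k=1}^{2N} (1 - 4 x^2 / k^2)^(-k^2 (-1)^k) has a pole
   of order 4m^2 at each integer x = m > 0 and a zero of order (2m+1)^2 at x = m + 1/2, so
   Gamma_3 (1 - x), Gamma_3 (1 + x) belong in the numerator. The formula has been printed with
   the reciprocal quotient, which is incompatible with this recurrence; it fails already
   at x = 0. *)

end

theory Submission
  imports Defs "HOL-Real_Asymp.Real_Asymp"
begin

text \<open>Write \<open>\<psi>\<close> for the digamma function. The recurrence determines the logarithmic derivatives of
  \<open>\<Gamma>\<^sub>2\<close> and \<open>\<Gamma>\<^sub>3\<close> on the positive reals up to a 1-periodic function, and the convexity condition forces
  that function to be constant. Up to polynomials they are therefore \<open>- (z - 1) \<psi>(z)\<close> and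
  \<open>(z - 1) (z - 2) \<psi>(z) / 2\<close>; by the identity theorem this holds off the nonpositive integers, so
  \<open>\<Gamma>\<^sub>2\<close> and \<open>\<Gamma>\<^sub>3\<close> have no zeros there. All undetermined constants cancel in the logarithmic derivative
  of the right-hand side, which becomes
  \<open>4 x\<^sup>2 (\<psi>(1 + x) - \<psi>(1 - x) - \<psi>(1/2 + x) + \<psi>(1/2 - x))\<close>. The logarithmic derivatives of the partial
  products converge to the same function, locally uniformly away from the nonzero half-integers. Hence the
  two sides are proportional.

  The constant of proportionality is the value of the right-hand side at 0, which involves the unknown
  \<open>c = \<Gamma>\<^sub>3(3/2)\<close>. On the upper half-plane the logarithmic derivative is
  \<open>4 t - 8 \<pi> t\<^sup>2 / sin (2 \<pi> t)\<close>, with an explicit antiderivative in terms of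
  \<open>\<Sum> q\<^sup>n / n\<^sup>s\<close> (\<open>n\<close> odd, \<open>q = exp (2 \<pi> i t)\<close>). Comparing the behaviour at \<open>t \<rightarrow> 0\<close> and \<open>t \<rightarrow> 1/2\<close>
  produces \<open>\<zeta>(3)\<close> and determines \<open>c\<close>.\<close>

section \<open>Logarithmic derivatives and periodic functions\<close>

text \<open>Both functions solve y' = H y, so their quotient has derivative 0. Here \<open>f\<close>
  may have zeros, which \<open>log_deriv_nonzero\<close> exploits.\<close>

lemma log_deriv_ratio_constant:
  fixes f g H :: "complex \<Rightarrow> complex"
  assumes "open S" "connected S"
    and f: "\<And>z. z \<in> S \<Longrightarrow> (f has_field_derivative H z * f z) (at z)"
    and g: "\<And>z. z \<in> S \<Longrightarrow> (g has_field_derivative H z * g z) (at z)"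
    and nz: "\<And>z. z \<in> S \<Longrightarrow> g z \<noteq> 0"
    and "a \<in> S" "b \<in> S"
  shows "f a / g a = f b / g b"
proof -
  have "((\<lambda>z. f z / g z) has_field_derivative 0) (at z)" if "z \<in> S" for z
    by (rule derivative_eq_intros f g nz that)+ (use nz[OF that] in \<open>auto simp: field_simps\<close>)
  from has_field_derivative_0_imp_constant_on[OF this \<open>connected S\<close> \<open>open S\<close>] 
  show ?thesis using assms by (auto simp: constant_on_def)
qed

text \<open>Near a zero, \<open>f\<close> is a constant multiple of the exponential of a primitive
  of \<open>H\<close>, and the constant is 0. So \<open>f\<close> vanishes on a ball, and by the
  identity theorem on all of \<open>S\<close>.\<close>

lemma log_deriv_nonzero:
  fixes f H :: "complex \<Rightarrow> complex"
  assumes "open S" "connected S" and H: "H holomorphic_on S"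
    and f: "\<And>z. z \<in> S \<Longrightarrow> (f has_field_derivative H z * f z) (at z)"
    and a: "a \<in> S" "f a \<noteq> 0" and "b \<in> S"
  shows "f b \<noteq> 0"
proof
  assume b0: "f b = 0"
  obtain r where r: "r > 0" "ball b r \<subseteq> S"
    using assms by (meson open_contains_ball)
  obtain K where "\<And>z. z \<in> ball b r \<Longrightarrow> (K has_field_derivative H z) (at z within ball b r)"
    using holomorphic_convex_primitive'[of "ball b r" H] H r by (meson holomorphic_on_subset convex_ball open_ball)
  hence K: "(K has_field_derivative H z) (at z)" if "z \<in> ball b r" for z
    using that by (metis at_within_open open_ball)
  have exp: "((\<lambda>z. exp (K z)) has_field_derivative H z * exp (K z)) (at z)" if "z \<in> ball b r" for z
    using K[OF that] by (auto intro!: derivative_eq_intros)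
  have "f z = 0" if "z \<in> ball b r" for z
  proof -
    have "f z / exp (K z) = f b / exp (K b)"
    proof (rule log_deriv_ratio_constant[of "ball b r" f H "\<lambda>z. exp (K z)" z b])
      show "(f has_field_derivative H z * f z) (at z)" if "z \<in> ball b r" for z
        using f r(2) that by blast
    qed (use exp that r in auto)
    thus ?thesis by (simp add: b0)
  qed
  moreover have "f holomorphic_on S"
    using f \<open>open S\<close> by (meson field_differentiable_at_within field_differentiable_def holomorphic_on_def)
  moreover have "b islimpt ball b r"
    using r by (simp add: islimpt_ball)
  ultimately have "f a = 0"
    using analytic_continuation[of f S "ball b r" b a] assms r by auto
  with a show False by simp
qed

text \<open>On a small ball \<open>f n y\<close> is \<open>f n x\<close> times the exponential of
  the integral of \<open>E n\<close> from \<open>x\<close> to \<open>y\<close>, and this integral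
  tends to 0 because \<open>E n\<close> does so uniformly. The limit \<open>c\<close> thus spreads
  over the ball, and connectedness carries it from \<open>a\<close> to \<open>b\<close>. It is
  applied to the quotient of a partial product by the right-hand side.\<close>

lemma log_deriv_tendsto:
  fixes f E :: "nat \<Rightarrow> complex \<Rightarrow> complex"
  assumes "open S" "connected S"
    and E: "\<And>n. E n holomorphic_on S"
    and f: "\<And>n z. z \<in> S \<Longrightarrow> (f n has_field_derivative E n z * f n z) (at z)"
    and lim: "\<And>z. z \<in> S \<Longrightarrow> \<exists>r>0. uniform_limit (ball z r) E (\<lambda>_. 0) sequentially"
    and a: "a \<in> S" "(\<lambda>n. f n a) \<longlonglongrightarrow> c" and b: "b \<in> S"
  shows "(\<lambda>n. f n b) \<longlonglongrightarrow> c"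
proof (rule connected_induction_simple[of S a b "\<lambda>z. (\<lambda>n. f n z) \<longlonglongrightarrow> c", OF \<open>connected S\<close> a(1) b a(2)])
  fix w assume w: "w \<in> S"
  obtain r1 where r1: "r1 > 0" "uniform_limit (ball w r1) E (\<lambda>_. 0) sequentially"
    using lim[OF w] by blast
  obtain r2 where r2: "r2 > 0" "ball w r2 \<subseteq> S"
    using w \<open>open S\<close> by (meson open_contains_ball)
  define r where "r = min r1 r2"
  define B where "B = ball w r"
  have r: "r > 0" "B \<subseteq> S" and ul: "uniform_limit B E (\<lambda>_. 0) sequentially"
    using r1 r2 by (auto simp: r_def B_def intro: uniform_limit_on_subset)
  have "(\<lambda>n. f n y) \<longlonglongrightarrow> c" if x: "x \<in> B" and y: "y \<in> B" and fx: "(\<lambda>n. f n x) \<longlonglongrightarrow> c" for x y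
  proof -
    have "\<exists>K. \<forall>z\<in>B. (K has_field_derivative E n z) (at z within B)" for n
      using holomorphic_convex_primitive'[of B "E n"] E r unfolding B_def
      by (metis holomorphic_on_subset convex_ball open_ball)
    then obtain K where K: "\<And>n z. z \<in> B \<Longrightarrow> (K n has_field_derivative E n z) (at z within B)"
      by metis
    have K': "(K n has_field_derivative E n z) (at z)" if "z \<in> B" for n z
      using that K by (metis at_within_open open_ball B_def)
    have exp: "((\<lambda>z. exp (K n z)) has_field_derivative E n z * exp (K n z)) (at z)" if "z \<in> B" for n z
      using K'[OF that] by (auto intro!: derivative_eq_intros)
    have eq: "f n y = f n x * exp (K n y - K n x)" for n
    proof -
      have "f n x / exp (K n x) = f n y / exp (K n y)"
      proof (rule log_deriv_ratio_constant[of B "f n" "E n" "\<lambda>z. exp (K n z)" x y])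
        show "(f n has_field_derivative E n z * f n z) (at z)" if "z \<in> B" for z
          using f r(2) that by blast
      qed (use exp x y in \<open>auto simp: B_def\<close>)
      thus ?thesis by (simp add: exp_diff field_simps)
    qed
    have "(\<lambda>n. K n y - K n x) \<longlonglongrightarrow> 0"
    proof (rule LIMSEQ_I)
      fix e :: real assume e: "e > 0"
      \<comment> \<open>The summand 1 keeps the denominator positive when
        \<open>x = y\<close>.\<close>
      define d where "d = e / (norm (y - x) + 1)"
      have d: "d > 0" "d * norm (y - x) < e" 
        using e by (auto simp: d_def field_simps add_pos_nonneg add_nonneg_pos intro!: divide_pos_pos)
      have "\<forall>\<^sub>F n in sequentially. \<forall>z\<in>B. dist (E n z) 0 < d"
        using ul d by (auto simp: uniform_limit_iff)
      then obtain n0 where n0: "\<And>n z. n \<ge> n0 \<Longrightarrow> z \<in> B \<Longrightarrow> norm (E n z) < d"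
        by (auto simp: eventually_sequentially)
      have "norm (K n y - K n x - 0) < e" if "n \<ge> n0" for n
      proof -
        have "norm (K n y - K n x) \<le> d * norm (y - x)"
          by (rule field_differentiable_bound[of B _ "E n"])
             (use K n0[OF that] x y in \<open>auto simp: B_def less_imp_le\<close>)
        with d show ?thesis by simp
      qed
      thus "\<exists>n0. \<forall>n\<ge>n0. norm (K n y - K n x - 0) < e" by blast
    qed
    hence "(\<lambda>n. f n x * exp (K n y - K n x)) \<longlonglongrightarrow> c * exp 0"
      by (intro tendsto_intros fx)
    thus ?thesis by (simp add: eq)
  qed
  thus "\<exists>T. openin (top_of_set S) T \<and> w \<in> T \<and> (\<forall>x\<in>T. \<forall>y\<in>T. (\<lambda>n. f n x) \<longlonglongrightarrow> c \<longrightarrow> (\<lambda>n. f n y) \<longlonglongrightarrow> c)"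
  proof (intro exI[of _ B] conjI ballI impI)
    show "openin (top_of_set S) B"
      using r(2) by (simp add: B_def \<open>open S\<close> openin_open_eq)
    show "w \<in> B" using r(1) by (simp add: B_def)
  qed
qed

text \<open>A nondecreasing function with equal values at \<open>x\<close> and \<open>x + 1\<close>
  is constant between them.\<close>

lemma periodic_deriv_nonneg_imp_zero:
  fixes p p' :: "real \<Rightarrow> real"
  assumes d: "\<And>x. x > 0 \<Longrightarrow> (p has_real_derivative p' x) (at x)"
    and per: "\<And>x. x > 0 \<Longrightarrow> p (x + 1) = p x"
    and nn: "\<And>x. x > 0 \<Longrightarrow> p' x \<ge> 0"
    and y: "y > 0"
  shows "p' y = 0"
proof -
  \<comment> \<open>This keeps \<open>x\<close> positive and puts \<open>y\<close> strictly inside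
    the period from \<open>x\<close> to \<open>x + 1\<close>, even when \<open>y\<close> is close to
    0.\<close>
  define x where "x = y - min y 1 / 2"
  have x: "x > 0" "x < y" "y < x + 1" using y by (auto simp: x_def min_def)
  have mono: "p u \<le> p v" if "0 < u" "u \<le> v" for u v
    by (rule DERIV_nonneg_imp_nondecreasing[OF that(2)]) (use that d nn in \<open>meson less_le_trans\<close>)
  have eq: "p u = p x" if "u \<in> {x<..<x+1}" for u
    using mono[of x u] mono[of u "x + 1"] per[of x] that x by auto
  have "((\<lambda>_. p x) has_real_derivative p' y) (at y)"
    using d[OF y] by (rule has_field_derivative_transform_within_open[of _ _ _ "{x<..<x+1}"])
       (use eq x in auto)
  thus ?thesis using DERIV_const DERIV_unique by blast
qed

lemma periodic_deriv:
  fixes p p' :: "real \<Rightarrow> real"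
  assumes d: "\<And>x. x > 0 \<Longrightarrow> (p has_real_derivative p' x) (at x)"
    and per: "\<And>x. x > 0 \<Longrightarrow> p (x + 1) = p x"
    and y: "y > 0"
  shows "p' (y + 1) = p' y"
proof -
  have "((\<lambda>x. p (x + 1)) has_real_derivative p' (y + 1)) (at y)"
    using d[of "y + 1"] y by (simp add: DERIV_shift)
  hence "(p has_real_derivative p' (y + 1)) (at y)"
    by (rule has_field_derivative_transform_within_open[of _ _ _ "{0<..}"]) (use y per in auto)
  thus ?thesis using d[OF y] DERIV_unique by blast
qed

text \<open>Periodicity turns an asymptotic one-sided bound on a derivative into a global sign, and a
  periodic function whose derivative has a constant sign is constant.\<close>
lemma periodic_higher_deriv_nonneg_imp_constant:
  fixes w :: "nat \<Rightarrow> real \<Rightarrow> real" and h :: "real \<Rightarrow> real"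
  assumes d: "\<And>j x. x > 0 \<Longrightarrow> (w j has_real_derivative w (Suc j) x) (at x)"
    and per: "\<And>x. x > 0 \<Longrightarrow> w 0 (x + 1) = w 0 x"
    and lower: "\<And>x. x \<ge> b \<Longrightarrow> w (Suc n) x \<ge> - h x"
    and h: "\<And>x. x > 0 \<Longrightarrow> (\<lambda>k. h (x + real k)) \<longlonglongrightarrow> 0"
    and x: "x > 0"
  shows "w (Suc 0) x = 0"
proof -
  have per': "w j (x + 1) = w j x" if "x > 0" for j x
    using that
  proof (induction j arbitrary: x)
    case (Suc j)
    show ?case by (rule periodic_deriv[OF d Suc.IH Suc.prems])
  qed (use per in auto)
  have per_nat: "w j (x + real k) = w j x" if "x > 0" for j x k
  proof (induction k)
    case (Suc k)
    have "w j (x + real k + 1) = w j (x + real k)" using that by (intro per') auto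
    with Suc show ?case by (simp add: algebra_simps)
  qed auto
  have nonneg: "w (Suc n) x \<ge> 0" if x: "x > 0" for x
  proof (rule tendsto_upperbound)
    show "(\<lambda>k. - h (x + real k)) \<longlonglongrightarrow> 0" using tendsto_minus[OF h[OF x]] by simp
    show "\<forall>\<^sub>F k in sequentially. - h (x + real k) \<le> w (Suc n) x"
      using eventually_ge_at_top[of "nat \<lceil>b\<rceil>"]
    proof eventually_elim
      case (elim k)
      hence "x + real k \<ge> b" using x by linarith
      from lower[OF this] per_nat[OF x] show ?case by simp
    qed
  qed auto
  \<comment> \<open>Descent from order \<open>n\<close> to order 0: once
    \<open>w (Suc (Suc j))\<close> vanishes, \<open>w (Suc j)\<close> is a constant, hence of one
    sign. It is the derivative of the periodic function \<open>w j\<close>, so the constant is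
    0.\<close>
  have "\<forall>x>0. w (Suc j) x = 0" if "j \<le> n" for j
    using that
  proof (induction j rule: inc_induct)
    case base
    show ?case using periodic_deriv_nonneg_imp_zero[of "w n" "w (Suc n)"] d per' nonneg by blast
  next
    case (step j)
    have const: "w (Suc j) u = w (Suc j) 1" if "u > 0" for u
      by (rule DERIV_isconst3[of 0 "u + 2"]) (use that step d[of _ "Suc j"] in auto)
    show ?case
    proof (cases "w (Suc j) 1 \<ge> 0")
      case True
      thus ?thesis using periodic_deriv_nonneg_imp_zero[of "w j" "w (Suc j)"] d per' const
        by (metis order_refl)
    next
      case False
      have "- w (Suc j) u = 0" if "u > 0" for u
      proof (rule periodic_deriv_nonneg_imp_zero[of "\<lambda>x. - w j x" "\<lambda>x. - w (Suc j) x"])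
        show "- w (Suc j) x \<ge> 0" if "x > 0" for x
          by (subst const[OF that]) (use False in auto)
      qed (use d per' that in \<open>auto intro: DERIV_minus\<close>)
      thus ?thesis by simp
    qed
  qed
  thus ?thesis using x by blast
qed

section \<open>Real derivatives as restrictions of complex derivatives\<close>

lemma holomorphic_real_restriction:
  fixes F :: "complex \<Rightarrow> complex" and f :: "real \<Rightarrow> real"
  assumes "F holomorphic_on U" "open U"
    and eq: "\<And>x. x > 0 \<Longrightarrow> of_real x \<in> U \<and> F (of_real x) = of_real (f x)"
    and x: "x > 0"
  shows "(f has_real_derivative deriv f x) (at x)" "deriv F (of_real x) = of_real (deriv f x)"
proof -
  have "(F has_field_derivative deriv F (of_real x)) (at (of_real x))"
    using assms by (meson holomorphic_derivI)
  hence "((\<lambda>t. F (of_real t)) has_vector_derivative deriv F (of_real x)) (at x)"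
    by (rule has_vector_derivative_real_field)
  hence v: "((\<lambda>t. of_real (f t)) has_vector_derivative deriv F (of_real x)) (at x)"
    by (rule has_vector_derivative_transform_within_open[of _ _ _ "{0<..}"]) (use eq x in auto)
  have "((\<lambda>t. Re (of_real (f t))) has_vector_derivative Re (deriv F (of_real x))) (at x)"
    by (rule bounded_linear.has_vector_derivative[OF bounded_linear_Re v])
  hence "(f has_real_derivative Re (deriv F (of_real x))) (at x)"
    by (simp add: has_real_derivative_iff_has_vector_derivative)
  thus *: "(f has_real_derivative deriv f x) (at x)" using DERIV_imp_deriv by metis
  have "((\<lambda>t. of_real (f t)) has_vector_derivative (of_real (deriv f x) :: complex)) (at x)"
    by (rule has_vector_derivative_of_real[OF *])
  with v show "deriv F (of_real x) = of_real (deriv f x)"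
    using vector_derivative_unique_at by blast
qed

text \<open>On the positive reals \<open>s\<close> is the restriction of the holomorphic function
  \<open>Ln (f z)\<close>. Its iterated real derivatives, which occur in the sign condition on the
  family, are therefore genuine derivatives and not default values of \<open>deriv\<close>.\<close>

lemma ln_Re_smooth:
  fixes f :: "complex \<Rightarrow> complex"
  assumes hol: "f holomorphic_on - \<int>\<^sub>\<le>\<^sub>0"
    and pos: "\<And>x::real. x > 0 \<Longrightarrow> f (of_real x) \<in> \<real> \<and> Re (f (of_real x)) > 0"
  defines "s \<equiv> \<lambda>t::real. ln (Re (f (of_real t)))"
  assumes x: "x > 0"
  shows "((deriv ^^ j) s has_real_derivative (deriv ^^ Suc j) s x) (at x)"
    and "of_real (deriv s x) = deriv f (of_real x) / f (of_real x)"
proof -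
  \<comment> \<open>Restricting to the preimage of the slit plane keeps \<open>Ln\<close> away from
    its branch cut. The positive reals stay inside because \<open>f\<close> is positive
    there.\<close>
  define U where "U = {z \<in> - \<int>\<^sub>\<le>\<^sub>0. f z \<in> - \<real>\<^sub>\<le>\<^sub>0}"
  have U: "open U" unfolding U_def
    using continuous_open_preimage[of "- \<int>\<^sub>\<le>\<^sub>0" f "- \<real>\<^sub>\<le>\<^sub>0"] hol
    by (simp add: holomorphic_on_imp_continuous_on vimage_def Int_def open_Compl)
  define F where "F = (\<lambda>z. Ln (f z))"
  have F: "F holomorphic_on U" unfolding F_def
    by (intro holomorphic_intros holomorphic_on_subset[OF hol]) (auto simp: U_def)
  have feq: "f (of_real x) = of_real (Re (f (of_real x)))" if "x > 0" for x
    using pos[OF that] by simp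
  have xU: "of_real x \<in> U" if "x > 0" for x
  proof -
    have "complex_of_real x \<notin> \<int>\<^sub>\<le>\<^sub>0" using that by (auto simp: nonpos_Ints_def complex_eq_iff)
    thus ?thesis using pos[OF that] by (auto simp: U_def complex_nonpos_Reals_iff)
  qed
  have "F (of_real x) = of_real (s x)" if "x > 0" for x
    using pos[OF that] feq[OF that] Ln_of_real[of "Re (f (of_real x))"] by (simp add: F_def s_def)
  hence eq: "((deriv ^^ j) F) holomorphic_on U \<and> (\<forall>x>0. (deriv ^^ j) F (of_real x) = of_real ((deriv ^^ j) s x))" for j
  proof (induction j)
    case (Suc j)
    thus ?case using holomorphic_real_restriction(2)[of "(deriv ^^ j) F" U "(deriv ^^ j) s"] U xU
      by (auto intro: holomorphic_deriv)
  qed (use F in auto)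
  show "((deriv ^^ j) s has_real_derivative (deriv ^^ Suc j) s x) (at x)"
    using holomorphic_real_restriction(1)[of "(deriv ^^ j) F" U "(deriv ^^ j) s"] U xU eq x by auto
  have "(f has_field_derivative deriv f (of_real x)) (at (of_real x))"
    using hol xU[OF x] by (intro holomorphic_derivI[OF hol]) (auto simp: U_def)
  hence "(F has_field_derivative (deriv f (of_real x) / f (of_real x))) (at (of_real x))"
    unfolding F_def using xU[OF x]
    by (auto intro!: derivative_eq_intros simp: U_def field_simps)
  hence "deriv F (of_real x) = deriv f (of_real x) / f (of_real x)" by (rule DERIV_imp_deriv)
  moreover have "deriv F (of_real x) = of_real (deriv s x)"
    using holomorphic_real_restriction(2)[of F U s] U F xU eq[of 0] x by auto
  ultimately show "of_real (deriv s x) = deriv f (of_real x) / f (of_real x)" by simp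
qed

section \<open>The logarithmic derivatives of the multiple gamma functions\<close>

lemma pos_real_not_nonpos_Int: "x > 0 \<Longrightarrow> (of_real x :: 'a :: real_normed_algebra_1) \<notin> \<int>\<^sub>\<le>\<^sub>0"
  by (auto simp: nonpos_Ints_def) (metis of_real_eq_iff of_real_of_int_eq less_le_not_le of_int_le_0_iff)

lemma connected_Compl_nonpos_Ints: "connected (- \<int>\<^sub>\<le>\<^sub>0 :: complex set)"
proof -
  have "countable (\<int>\<^sub>\<le>\<^sub>0 :: complex set)"
    by (rule countable_subset[OF nonpos_Ints_subset_Ints]) (auto simp: Ints_def)
  hence "connected (UNIV - \<int>\<^sub>\<le>\<^sub>0 :: complex set)"
    by (intro connected_open_diff_countable) (auto simp: connected_UNIV)
  thus ?thesis by (simp add: Compl_eq_Diff_UNIV)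
qed

section \<open>Decay of the trigamma function and a polygamma inequality\<close>

lemma trigamma_shift_tendsto_0:
  assumes "(x::real) > 0"
  shows "(\<lambda>k. Polygamma 1 (x + real k)) \<longlonglongrightarrow> 0"
proof -
  have "(\<lambda>k. inverse ((x + real k) ^ 2)) sums Polygamma 1 x"
    using Polygamma_LIMSEQ[of x 1] assms by (simp add: numeral_2_eq_2)
  hence "(\<lambda>m. Polygamma 1 x - (\<Sum>k<m. inverse ((x + real k) ^ 2))) \<longlonglongrightarrow> Polygamma 1 x - Polygamma 1 x"
    unfolding sums_def by (intro tendsto_intros)
  moreover have "Polygamma 1 (x + real m) = Polygamma 1 x - (\<Sum>k<m. inverse ((x + real k) ^ 2))" for m
    using Polygamma_plus_of_nat[of m x 1] assms by (auto simp: field_simps numeral_2_eq_2)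
  ultimately show ?thesis by simp
qed

text \<open>Compare the two series term by term, using x^2 \<le> (x + k)^2; the 6 is the factorial
  3! in the series of \<open>Polygamma 3\<close>. This controls the term of wrong sign in the bound
  needed for \<Gamma>_3.\<close>

lemma Polygamma_3_le:
  assumes "(x::real) > 0"
  shows "x\<^sup>2 * Polygamma 3 x \<le> 6 * Polygamma 1 x"
proof -
  have 1: "(\<lambda>k. inverse ((x + real k) ^ 2)) sums Polygamma 1 x"
    using Polygamma_LIMSEQ[of x 1] assms by (simp add: numeral_2_eq_2)
  have 3: "(\<lambda>k. inverse ((x + real k) ^ 4)) sums (Polygamma 3 x / 6)"
    using Polygamma_LIMSEQ[of x 3] assms by (simp add: eval_nat_numeral)
  have "x\<^sup>2 * (Polygamma 3 x / 6) \<le> Polygamma 1 x"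
  proof (rule sums_le[OF _ sums_mult[OF 3] 1])
    fix k
    have "x\<^sup>2 * inverse ((x + real k) ^ 4) \<le> (x + real k)\<^sup>2 * inverse ((x + real k) ^ 4)"
      using assms by (intro mult_right_mono power_mono) auto
    also have "\<dots> = inverse ((x + real k) ^ 2)"
      using assms power_add[of "x + real k" 2 2] by (simp add: divide_simps)
    finally show "x\<^sup>2 * inverse ((x + real k) ^ 4) \<le> inverse ((x + real k) ^ 2)" .
  qed
  thus ?thesis by simp
qed

lemma multiple_GammaD:
  assumes "multiple_Gamma_family \<Gamma>" "n \<ge> 1"
  shows multiple_Gamma_1: "\<Gamma> n 1 = 1"
    and multiple_Gamma_rec: "\<And>z. z \<notin> \<int>\<^sub>\<le>\<^sub>0 \<Longrightarrow> \<Gamma> (Suc n) (z + 1) = \<Gamma> (Suc n) z / \<Gamma> n z"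
    and multiple_Gamma_holomorphic: "\<Gamma> n holomorphic_on (- \<int>\<^sub>\<le>\<^sub>0)"
    and multiple_Gamma_nonpos_Int: "\<And>z. z \<in> \<int>\<^sub>\<le>\<^sub>0 \<Longrightarrow> \<Gamma> n z = 0"
    and multiple_Gamma_pos: "\<And>x::real. x > 0 \<Longrightarrow> \<Gamma> n (of_real x) \<in> \<real> \<and> Re (\<Gamma> n (of_real x)) > 0"
    and multiple_Gamma_sign: "\<And>x::real. x > 0 \<Longrightarrow>
           (-1) ^ (n + 1) * (deriv ^^ (n + 1)) (\<lambda>t::real. ln (Re (\<Gamma> n (of_real t)))) x \<ge> 0"
  using assms unfolding multiple_Gamma_family_def by blast+

context
  fixes \<Gamma> :: "nat \<Rightarrow> complex \<Rightarrow> complex"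
  assumes fam: "multiple_Gamma_family \<Gamma>"
begin

section \<open>Logarithms of the multiple gamma functions on the positive reals\<close>

private definition L :: "nat \<Rightarrow> real \<Rightarrow> real" where
  "L n = (\<lambda>t. ln (Re (\<Gamma> n (of_real t))))"

private lemma L_deriv:
  assumes "n \<ge> 1" "x > 0"
  shows "((deriv ^^ j) (L n) has_real_derivative (deriv ^^ Suc j) (L n) x) (at x)"
    and "of_real (deriv (L n) x) = deriv (\<Gamma> n) (of_real x) / \<Gamma> n (of_real x)"
  using ln_Re_smooth(1)[of "\<Gamma> n" x j] ln_Re_smooth(2)[of "\<Gamma> n" x] multiple_Gamma_holomorphic[OF fam assms(1)]
    multiple_Gamma_pos[OF fam assms(1)] assms(2) unfolding L_def by blast+

private lemma L_rec:
  assumes "n \<ge> 1" "x > 0"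
  shows "L (Suc n) (x + 1) = L (Suc n) x - L n x"
proof -
  define a where "a = Re (\<Gamma> (Suc n) (of_real x))"
  define b where "b = Re (\<Gamma> n (of_real x))"
  have a: "\<Gamma> (Suc n) (of_real x) = of_real a" "a > 0" and b: "\<Gamma> n (of_real x) = of_real b" "b > 0"
    using multiple_Gamma_pos[OF fam, of "Suc n" x] multiple_Gamma_pos[OF fam, of n x] assms
    by (auto simp: a_def b_def)
  have "\<Gamma> (Suc n) (of_real (x + 1)) = of_real (a / b)"
    using multiple_Gamma_rec[OF fam assms(1) pos_real_not_nonpos_Int[OF assms(2)]] a b by simp
  with a b show ?thesis by (simp add: L_def ln_div)
qed

private lemma L_deriv_rec:
  assumes "n \<ge> 1" "x > 0"
  shows "deriv (L (Suc n)) (x + 1) = deriv (L (Suc n)) x - deriv (L n) x"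
proof -
  have "(L (Suc n) has_real_derivative deriv (L (Suc n)) (x + 1)) (at (x + 1))"
    using L_deriv(1)[of "Suc n" "x + 1" 0] assms by simp
  hence "((\<lambda>t. L (Suc n) (t + 1)) has_real_derivative deriv (L (Suc n)) (x + 1)) (at x)"
    by (simp add: DERIV_shift)
  hence "((\<lambda>t. L (Suc n) t - L n t) has_real_derivative deriv (L (Suc n)) (x + 1)) (at x)"
    by (rule has_field_derivative_transform_within_open[of _ _ _ "{0<..}"]) (use assms L_rec in auto)
  moreover have "((\<lambda>t. L (Suc n) t - L n t) has_real_derivative deriv (L (Suc n)) x - deriv (L n) x) (at x)"
    using L_deriv(1)[of "Suc n" x 0] L_deriv(1)[of n x 0] assms by (intro DERIV_diff) auto
  ultimately show ?thesis using DERIV_unique by blast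
qed

private lemma deriv_L1: "x > 0 \<Longrightarrow> deriv (L 1) x = Digamma x"
proof -
  assume x: "x > 0"
  have g: "\<Gamma> 1 = Gamma" using fam by (simp add: multiple_Gamma_family_def)
  have nz: "complex_of_real x \<notin> \<int>\<^sub>\<le>\<^sub>0" using x by (rule pos_real_not_nonpos_Int)
  have "deriv Gamma (complex_of_real x) = Gamma (of_real x) * Digamma (of_real x)"
    by (intro DERIV_imp_deriv has_field_derivative_Gamma nz)
  hence "complex_of_real (deriv (L 1) x) = Digamma (of_real x)"
    using L_deriv(2)[of 1 x] x nz by (simp add: g[unfolded One_nat_def] Gamma_eq_zero_iff)
  also have "\<dots> = of_real (Digamma x)" using x by (intro Polygamma_of_real) auto
  finally show ?thesis by (simp only: of_real_eq_iff)
qed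

text \<open>The function -(x - 1) \<open>Digamma x\<close> + x solves the recurrence for the
  derivative of \<open>L 2\<close>. The difference of two solutions is 1-periodic, and the sign
  condition of order 3 makes it constant by
  \<open>periodic_higher_deriv_nonneg_imp_constant\<close>.\<close>

private lemma L2_log_deriv: "\<exists>c. \<forall>x>0. deriv (L 2) x = - ((x - 1) * Digamma x - x + c)"
proof -
  \<comment> \<open>This is the derivative of order \<open>j\<close> of the periodic difference, by
    the Leibniz rule. At \<open>j = 0\<close> the truncated \<open>j - 1\<close> is harmless, as its
    term carries the factor \<open>real j\<close>.\<close>
  define w where "w = (\<lambda>j x. - (deriv ^^ Suc j) (L 2) x - (x - 1) * Polygamma j x
      - real j * Polygamma (j - 1) x + (if j = 0 then x else if j = 1 then 1 else 0))"
  have d: "(w j has_real_derivative w (Suc j) x) (at x)" if "x > 0" for j x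
  proof -
    have x: "x \<notin> \<int>\<^sub>\<le>\<^sub>0" using that pos_real_not_nonpos_Int[of x, where 'a = real] by simp
    consider "j = 0" | "j = 1" | i where "j = Suc (Suc i)" by (metis One_nat_def not0_implies_Suc)
    thus ?thesis
    proof cases
      case 1
      show ?thesis unfolding w_def 1
        by (rule derivative_eq_intros L_deriv(1) has_field_derivative_Polygamma x that refl | simp)+
    next
      case 2
      show ?thesis unfolding w_def 2
        by (rule derivative_eq_intros L_deriv(1) has_field_derivative_Polygamma x that refl | simp)+
    next
      case 3
      show ?thesis unfolding w_def 3
        by (rule derivative_eq_intros L_deriv(1) has_field_derivative_Polygamma x that refl | simp add: algebra_simps)+
    qed
  qed
  have per: "w 0 (x + 1) = w 0 x" if "x > 0" for x
    using L_deriv_rec[of 1 x] deriv_L1[of x] Digamma_plus1[of x] that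
    by (simp add: w_def field_simps numeral_2_eq_2)
  \<comment> \<open>The sign condition handles the derivative of \<open>L 2\<close>, and for
    \<open>x \<ge> 1\<close> the term with \<open>Polygamma 2\<close> has the right sign. Only a
    multiple of the trigamma function is left, which decays.\<close>
  have lower: "w (Suc 1) x \<ge> - (2 * Polygamma 1 x)" if "x \<ge> 1" for x
  proof -
    have "Polygamma 2 x \<le> 0" using Polygamma_real_even_neg[of x 2] that by simp
    hence "(x - 1) * Polygamma 2 x \<le> 0" using that by (intro mult_nonneg_nonpos) auto
    thus ?thesis using multiple_Gamma_sign[OF fam, of 2 x] that
      by (simp add: w_def L_def eval_nat_numeral)
  qed
  have h: "(\<lambda>k. 2 * Polygamma 1 (x + real k)) \<longlonglongrightarrow> 0" if "x > 0" for x
    using tendsto_mult_right_zero[OF trigamma_shift_tendsto_0[OF that]] by simp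
  have w1: "w (Suc 0) x = 0" if "x > 0" for x
    using periodic_higher_deriv_nonneg_imp_constant[of w 1 "\<lambda>x. 2 * Polygamma 1 x" 1] d per lower h that
    by blast
  have "w 0 x = w 0 1" if "x > 0" for x
    by (rule DERIV_isconst3[of 0 "x + 2"]) (use that d[of _ 0] w1 in auto)
  hence "\<forall>x>0. deriv (L 2) x = - ((x - 1) * Digamma x - x + w 0 1)"
    by (simp add: w_def algebra_simps)
  thus ?thesis by blast
qed

text \<open>The argument of \<open>L2_log_deriv\<close> one level up: the recurrence now involves
  the formula for \<open>L 2\<close>, and the sign condition has order 4.\<close>

private lemma L3_log_deriv:
  "\<exists>b c. \<forall>x>0. deriv (L 3) x = (x - 1) * (x - 2) / 2 * Digamma x - 3 / 4 * x\<^sup>2 + b * x + c"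
proof -
  obtain c where c: "\<And>x. x > 0 \<Longrightarrow> deriv (L 2) x = - ((x - 1) * Digamma x - x + c)"
    using L2_log_deriv by blast
  \<comment> \<open>Under the shift by 1 the digamma part and the quadratic part contribute the
    constants -1/2 and -3/4. Adding 5/4 compensates them, so that \<open>w 0\<close> below is
    periodic.\<close>
  define b where "b = c + 5 / 4"
  define q where "q = (\<lambda>(j::nat) (x::real). if j = 0 then - 3 / 4 * x\<^sup>2 + b * x else if j = 1 then - 3 / 2 * x + b
      else if j = 2 then - 3 / 2 else (0::real))"
  define w where "w = (\<lambda>j x. (deriv ^^ Suc j) (L 3) x - (x - 1) * (x - 2) / 2 * Polygamma j x
      - real j * (x - 3 / 2) * Polygamma (j - 1) x - real j * (real j - 1) / 2 * Polygamma (j - 2) x - q j x)"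
  have q: "(q j has_real_derivative q (Suc j) x) (at x)" for j x
  proof -
    consider "j = 0" | "j = 1" | i where "j = Suc (Suc i)" by (metis One_nat_def not0_implies_Suc)
    thus ?thesis
      by cases (auto simp: q_def intro!: derivative_eq_intros)
  qed
  have d: "(w j has_real_derivative w (Suc j) x) (at x)" if "x > 0" for j x
  proof -
    have x: "x \<notin> \<int>\<^sub>\<le>\<^sub>0" using that pos_real_not_nonpos_Int[of x, where 'a = real] by simp
    consider "j = 0" | "j = 1" | i where "j = Suc (Suc i)" by (metis One_nat_def not0_implies_Suc)
    thus ?thesis
    proof cases
      case 1
      show ?thesis unfolding w_def 1
        by (rule derivative_eq_intros L_deriv(1) has_field_derivative_Polygamma q x that refl | simp add: field_simps)+
    next
      case 2
      show ?thesis unfolding w_def 2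
        by (rule derivative_eq_intros L_deriv(1) has_field_derivative_Polygamma q x that refl | simp add: field_simps)+
    next
      case 3
      show ?thesis unfolding w_def 3
        by (rule derivative_eq_intros L_deriv(1) has_field_derivative_Polygamma q x that refl | simp add: field_simps)+
    qed
  qed
  have per: "w 0 (x + 1) = w 0 x" if "x > 0" for x
  proof -
    have L: "deriv (L 3) (x + 1) = deriv (L 3) x + ((x - 1) * Digamma x - x + c)"
      using L_deriv_rec[of 2 x] c[of x] that by simp
    have "x * (x - 1) / 2 * Digamma (x + 1) = x * (x - 1) / 2 * Digamma x + (x - 1) / 2"
      using that by (subst Digamma_plus1) (auto simp: field_simps)
    thus ?thesis using L
      by (simp add: w_def q_def b_def field_simps power2_eq_square)
  qed
  \<comment> \<open>The term with \<open>Polygamma 2\<close> has the right sign. The other two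
    corrections, one of them by \<open>Polygamma_3_le\<close>, cost at most
    \<open>3 * Polygamma 1 x\<close> each.\<close>
  have lower: "w (Suc 2) x \<ge> - (6 * Polygamma 1 x)" if "x \<ge> 2" for x
  proof -
    have 2: "(x - 3 / 2) * Polygamma 2 x \<le> 0"
      using Polygamma_real_even_neg[of x 2] that by (intro mult_nonneg_nonpos) auto
    have "Polygamma 3 x \<ge> 0"
      using Polygamma_real_odd_pos[of x 3] pos_real_not_nonpos_Int[of x, where 'a = real] that by simp
    moreover have "(x - 1) * (x - 2) \<le> x\<^sup>2" using that by (simp add: power2_eq_square algebra_simps)
    ultimately have "(x - 1) * (x - 2) * Polygamma 3 x \<le> x\<^sup>2 * Polygamma 3 x"
      by (rule mult_right_mono[rotated])
    also have "\<dots> \<le> 6 * Polygamma 1 x" using that by (intro Polygamma_3_le) auto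
    finally have 3: "(x - 1) * (x - 2) / 2 * Polygamma 3 x \<le> 3 * Polygamma 1 x" by simp
    have 4: "(deriv ^^ Suc 3) (L 3) x \<ge> 0"
      using multiple_Gamma_sign[OF fam, of 3 x] that by (simp add: L_def)
    have "w (Suc 2) x = (deriv ^^ Suc 3) (L 3) x - (x - 1) * (x - 2) / 2 * Polygamma 3 x
        - 3 * ((x - 3 / 2) * Polygamma 2 x) - 3 * Polygamma 1 x"
      by (simp add: w_def q_def eval_nat_numeral algebra_simps)
    with 2 3 4 show ?thesis by linarith
  qed
  have h: "(\<lambda>k. 6 * Polygamma 1 (x + real k)) \<longlonglongrightarrow> 0" if "x > 0" for x
    using tendsto_mult_right_zero[OF trigamma_shift_tendsto_0[OF that]] by simp
  have w1: "w (Suc 0) x = 0" if "x > 0" for x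
    using periodic_higher_deriv_nonneg_imp_constant[of w 2 "\<lambda>x. 6 * Polygamma 1 x" 2] d per lower h that
    by blast
  have "w 0 x = w 0 1" if "x > 0" for x
    by (rule DERIV_isconst3[of 0 "x + 2"]) (use that d[of _ 0] w1 in auto)
  hence "\<forall>x>0. deriv (L 3) x = (x - 1) * (x - 2) / 2 * Digamma x - 3 / 4 * x\<^sup>2 + b * x + w 0 1"
    by (simp add: w_def q_def algebra_simps)
  thus ?thesis by blast
qed

text \<open>The differential equation holds on the positive reals, which accumulate at 1, hence on
  the whole connected domain by the identity theorem. Then \<open>log_deriv_nonzero\<close> excludes
  zeros, starting from the value 1 at 1.\<close>

private lemma log_deriv_extend:
  assumes n: "n \<ge> 1" and H: "H holomorphic_on - \<int>\<^sub>\<le>\<^sub>0"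
    and eq: "\<And>x. x > 0 \<Longrightarrow> of_real (deriv (L n) x) = H (of_real x)"
    and z: "z \<notin> \<int>\<^sub>\<le>\<^sub>0"
  shows "(\<Gamma> n has_field_derivative H z * \<Gamma> n z) (at z)" "\<Gamma> n z \<noteq> 0"
proof -
  have opn: "open (- \<int>\<^sub>\<le>\<^sub>0 :: complex set)" by (simp add: open_Compl)
  have hol: "\<Gamma> n holomorphic_on - \<int>\<^sub>\<le>\<^sub>0" by (rule multiple_Gamma_holomorphic[OF fam n])
  have ext: "deriv (\<Gamma> n) z - H z * \<Gamma> n z = 0" if "z \<in> - \<int>\<^sub>\<le>\<^sub>0" for z
  proof (rule analytic_continuation[of "\<lambda>z. deriv (\<Gamma> n) z - H z * \<Gamma> n z" "- \<int>\<^sub>\<le>\<^sub>0" "complex_of_real ` {0<..}" 1])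
    show "(\<lambda>z. deriv (\<Gamma> n) z - H z * \<Gamma> n z) holomorphic_on - \<int>\<^sub>\<le>\<^sub>0"
      by (intro holomorphic_intros holomorphic_deriv hol H opn)
    show "complex_of_real ` {0<..} \<subseteq> - \<int>\<^sub>\<le>\<^sub>0" using pos_real_not_nonpos_Int by auto
    show "1 islimpt complex_of_real ` {0<..}"
      unfolding islimpt_approachable
    proof (intro allI impI)
      fix e :: real assume "e > 0"
      thus "\<exists>x'\<in>complex_of_real ` {0<..}. x' \<noteq> 1 \<and> dist x' 1 < e"
        by (intro bexI[of _ "of_real (1 + e / 2)"] imageI) (auto simp: dist_norm)
    qed
    show "deriv (\<Gamma> n) z - H z * \<Gamma> n z = 0" if z: "z \<in> complex_of_real ` {0<..}" for z
    proof -
      obtain x where x: "z = of_real x" "x > 0" using z by auto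
      have "\<Gamma> n z \<noteq> 0" using multiple_Gamma_pos[OF fam n x(2)] x(1) by auto
      thus ?thesis using L_deriv(2)[OF n x(2)] eq[OF x(2)] x(1) by (simp add: field_simps)
    qed
  qed (use that connected_Compl_nonpos_Ints opn in auto)
  have D: "(\<Gamma> n has_field_derivative H z * \<Gamma> n z) (at z)" if "z \<in> - \<int>\<^sub>\<le>\<^sub>0" for z
    using holomorphic_derivI[OF hol opn that] ext[OF that] by simp
  show "(\<Gamma> n has_field_derivative H z * \<Gamma> n z) (at z)" using D z by simp
  show "\<Gamma> n z \<noteq> 0"
    by (rule log_deriv_nonzero[OF opn connected_Compl_nonpos_Ints H D, of 1])
       (use z multiple_Gamma_1[OF fam n] in auto)
qed

lemma multiple_Gamma_2_log_deriv:
  obtains c :: complex where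
    "\<And>z. z \<notin> \<int>\<^sub>\<le>\<^sub>0 \<Longrightarrow> (\<Gamma> 2 has_field_derivative - ((z - 1) * Digamma z - z + c) * \<Gamma> 2 z) (at z)"
    "\<And>z. z \<notin> \<int>\<^sub>\<le>\<^sub>0 \<Longrightarrow> \<Gamma> 2 z \<noteq> 0"
proof -
  obtain c where c: "\<And>x. x > 0 \<Longrightarrow> deriv (L 2) x = - ((x - 1) * Digamma x - x + c)"
    using L2_log_deriv by blast
  define H where "H = (\<lambda>z::complex. - ((z - 1) * Digamma z - z + of_real c))"
  have "H holomorphic_on - \<int>\<^sub>\<le>\<^sub>0" unfolding H_def by (intro holomorphic_intros) auto
  moreover have "of_real (deriv (L 2) x) = H (of_real x)" if "x > 0" for x
    using c[OF that] Polygamma_of_real[of x 0, where 'a = complex] that by (simp add: H_def)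
  ultimately show ?thesis
    using log_deriv_extend[of 2 H] by (intro that[of "of_real c"]) (auto simp: H_def)
qed

lemma multiple_Gamma_3_log_deriv:
  obtains b c :: complex where
    "\<And>z. z \<notin> \<int>\<^sub>\<le>\<^sub>0 \<Longrightarrow> (\<Gamma> 3 has_field_derivative
       ((z - 1) * (z - 2) / 2 * Digamma z - 3 / 4 * z\<^sup>2 + b * z + c) * \<Gamma> 3 z) (at z)"
    "\<And>z. z \<notin> \<int>\<^sub>\<le>\<^sub>0 \<Longrightarrow> \<Gamma> 3 z \<noteq> 0"
proof -
  obtain b c where c: "\<And>x. x > 0 \<Longrightarrow>
      deriv (L 3) x = (x - 1) * (x - 2) / 2 * Digamma x - 3 / 4 * x\<^sup>2 + b * x + c"
    using L3_log_deriv by blast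
  define H where "H = (\<lambda>z::complex. (z - 1) * (z - 2) / 2 * Digamma z - 3 / 4 * z\<^sup>2 + of_real b * z + of_real c)"
  have "H holomorphic_on - \<int>\<^sub>\<le>\<^sub>0" unfolding H_def by (intro holomorphic_intros) auto
  moreover have "of_real (deriv (L 3) x) = H (of_real x)" if "x > 0" for x
    using c[OF that] Polygamma_of_real[of x 0, where 'a = complex] that by (simp add: H_def)
  ultimately show ?thesis
    using log_deriv_extend[of 3 H] by (intro that[of "of_real b" "of_real c"]) (auto simp: H_def)
qed

end

section \<open>The right-hand side\<close>

text \<open>Differentiate the reflection formula of the Gamma function and divide by it.\<close>

lemma Digamma_reflection:
  fixes z :: complex
  assumes z: "z \<notin> \<int>"
  shows "Digamma (1 - z) - Digamma z = of_real pi * cot (of_real pi * z)"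
proof -
  have z1: "z \<notin> \<int>\<^sub>\<le>\<^sub>0" "1 - z \<notin> \<int>\<^sub>\<le>\<^sub>0"
    using z nonpos_Ints_subset_Ints Ints_diff[of 1 "1 - z"] by auto
  have s: "sin (of_real pi * z) \<noteq> 0"
    using z by (auto simp: sin_eq_0 mult_ac)
  have "((\<lambda>z. Gamma z * Gamma (1 - z)) has_field_derivative
      Gamma z * Gamma (1 - z) * (Digamma z - Digamma (1 - z))) (at z)"
    using z1 by (auto intro!: derivative_eq_intros simp: algebra_simps)
  moreover have "((\<lambda>z. of_real pi / sin (of_real pi * z)) has_field_derivative
      - (of_real pi * cos (of_real pi * z) * of_real pi) / (sin (of_real pi * z))\<^sup>2) (at z)"
    using s by (auto intro!: derivative_eq_intros simp: power2_eq_square)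
  ultimately have "of_real pi / sin (of_real pi * z) * (Digamma z - Digamma (1 - z)) =
      - (of_real pi * cos (of_real pi * z) * of_real pi) / (sin (of_real pi * z))\<^sup>2"
    unfolding Gamma_reflection_complex by (rule DERIV_unique)
  also have "\<dots> = of_real pi / sin (of_real pi * z) * (- of_real pi * cot (of_real pi * z))"
    by (simp add: cot_def power2_eq_square)
  finally have "Digamma z - Digamma (1 - z) = - of_real pi * cot (of_real pi * z)"
    using s by (subst (asm) mult_cancel_left) auto
  thus ?thesis by (simp add: algebra_simps)
qed

text \<open>In the difference of the two digamma series the harmonic terms and Euler's constant
  cancel.\<close>

lemma Digamma_diff_sums:
  fixes a x :: complex
  assumes "a + x \<notin> \<int>\<^sub>\<le>\<^sub>0" "a - x \<notin> \<int>\<^sub>\<le>\<^sub>0"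
  shows "(\<lambda>k. 2 * x / ((a + of_nat k)\<^sup>2 - x\<^sup>2)) sums (Digamma (a + x) - Digamma (a - x))"
proof -
  have nz: "a + x + of_nat k \<noteq> 0" "a - x + of_nat k \<noteq> 0" for k
    using assms plus_of_nat_eq_0_imp by blast+
  have D: "(\<lambda>k. inverse (of_nat (Suc k)) - inverse (z + of_nat k)) sums (Digamma z + euler_mascheroni)"
    if "z \<notin> \<int>\<^sub>\<le>\<^sub>0" for z :: complex
  proof -
    have "z \<noteq> 0" using that by auto
    from summable_sums[OF summable_Digamma[OF this]] show ?thesis by (simp add: Digamma_def)
  qed
  have "(\<lambda>k. (inverse (of_nat (Suc k)) - inverse (a + x + of_nat k)) -
      (inverse (of_nat (Suc k)) - inverse (a - x + of_nat k))) sums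
      ((Digamma (a + x) + euler_mascheroni) - (Digamma (a - x) + euler_mascheroni))"
    by (intro sums_diff D assms)
  moreover have "(inverse (of_nat (Suc k)) - inverse (a + x + of_nat k)) -
      (inverse (of_nat (Suc k)) - inverse (a - x + of_nat k)) = 2 * x / ((a + of_nat k)\<^sup>2 - x\<^sup>2)" for k
  proof -
    have "(a + of_nat k)\<^sup>2 - x\<^sup>2 = (a + x + of_nat k) * (a - x + of_nat k)"
      by (simp add: power2_eq_square algebra_simps)
    thus ?thesis using nz[of k] by (simp add: divide_simps) (simp add: algebra_simps)
  qed
  ultimately show ?thesis by simp
qed

text \<open>Exactly the zeros and poles of the limit function are removed. The origin stays, as the
  base point where all partial products equal 1.\<close>

definition half_Int_Compl :: "complex set" where
  "half_Int_Compl = {x. x = 0 \<or> 2 * x \<notin> \<int>}"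

lemma half_Int_Compl_eq: "half_Int_Compl = UNIV - (\<lambda>x. x / 2) ` (\<int> - {0})"
proof -
  have "x \<in> (\<lambda>x. x / 2) ` (\<int> - {0}) \<longleftrightarrow> x \<noteq> 0 \<and> 2 * x \<in> \<int>" for x :: complex
    by (auto intro: image_eqI[of _ _ "2 * x"])
  thus ?thesis by (auto simp: half_Int_Compl_def)
qed

lemma open_half_Int_Compl: "open half_Int_Compl"
proof -
  have "closed ((\<lambda>x::complex. (1/2) *\<^sub>R x) ` (\<int> - {0}))"
    by (intro closed_scaling closed_subset_Ints) auto
  moreover have "(\<lambda>x::complex. (1/2) *\<^sub>R x) = (\<lambda>x. x / 2)" by (auto simp: scaleR_conv_of_real)
  ultimately show ?thesis unfolding half_Int_Compl_eq by (metis open_Diff open_UNIV)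
qed

lemma connected_half_Int_Compl: "connected half_Int_Compl"
  unfolding half_Int_Compl_eq
proof (rule connected_open_diff_countable)
  have "countable (\<int> :: complex set)" by (auto simp: Ints_def)
  thus "countable ((\<lambda>x::complex. x / 2) ` (\<int> - {0}))" by blast
qed (auto intro: connected_UNIV)

text \<open>A nonpositive integer \<open>a + s * x\<close> makes \<open>2 * x\<close> an integer, so
  \<open>x = 0\<close> on this domain; but then \<open>a\<close>, which has positive real part,
  would be a nonpositive integer.\<close>

lemma half_Int_Compl_shift:
  assumes x: "x \<in> half_Int_Compl"
  shows "1 + x \<notin> \<int>\<^sub>\<le>\<^sub>0" "1 - x \<notin> \<int>\<^sub>\<le>\<^sub>0" "1 / 2 + x \<notin> \<int>\<^sub>\<le>\<^sub>0" "1 / 2 - x \<notin> \<int>\<^sub>\<le>\<^sub>0"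
    "3 / 2 + x \<notin> \<int>\<^sub>\<le>\<^sub>0" "3 / 2 - x \<notin> \<int>\<^sub>\<le>\<^sub>0"
proof -
  have *: "a + s * x \<notin> \<int>\<^sub>\<le>\<^sub>0" if a: "2 * a \<in> \<int>" "Re a > 0" and s: "s = 1 \<or> s = -1" for a s
  proof
    assume *: "a + s * x \<in> \<int>\<^sub>\<le>\<^sub>0"
    hence "2 * (a + s * x) - 2 * a \<in> \<int>"
      using a nonpos_Ints_subset_Ints by (intro Ints_diff[OF Ints_mult[of 2]]) auto
    hence "s * (2 * x) \<in> \<int>" by (simp add: algebra_simps)
    hence "2 * x \<in> \<int>" using s by (auto simp: minus_in_Ints_iff)
    hence "x = 0" using x by (auto simp: half_Int_Compl_def)
    with * a show False by (auto elim!: nonpos_Ints_cases)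
  qed
  show "1 + x \<notin> \<int>\<^sub>\<le>\<^sub>0" "1 - x \<notin> \<int>\<^sub>\<le>\<^sub>0" "1 / 2 + x \<notin> \<int>\<^sub>\<le>\<^sub>0" "1 / 2 - x \<notin> \<int>\<^sub>\<le>\<^sub>0"
    "3 / 2 + x \<notin> \<int>\<^sub>\<le>\<^sub>0" "3 / 2 - x \<notin> \<int>\<^sub>\<le>\<^sub>0"
    using *[of 1 1] *[of 1 "-1"] *[of "1/2" 1] *[of "1/2" "-1"] *[of "3/2" 1] *[of "3/2" "-1"]
    by auto
qed

lemma cos_pi_nonzero: "x \<in> half_Int_Compl \<Longrightarrow> cos (of_real pi * x) \<noteq> 0"
proof
  assume x: "x \<in> half_Int_Compl" and "cos (of_real pi * x) = 0"
  then obtain n :: int where "of_real pi * x = of_real (of_int n * pi) + of_real pi / 2"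
    unfolding cos_eq_0 by blast
  hence "of_real pi * x = of_real pi * (of_int n + 1 / 2)"
    by (simp add: algebra_simps)
  hence "x = of_int n + 1 / 2" by (subst (asm) mult_cancel_left) auto
  hence *: "2 * x = of_int (2 * n + 1)" by simp
  have "2 * x \<in> \<int>" unfolding * by (rule Ints_of_int)
  hence "x = 0" using x by (simp add: half_Int_Compl_def)
  hence "(of_int (2 * n + 1) :: complex) = 0" using * by simp
  hence "2 * n + 1 = 0" unfolding of_int_eq_0_iff .
  thus False by presburger
qed

section \<open>Rules for logarithmic derivatives, written as factors of the function\<close>

lemma log_deriv_mult:
  assumes "(f has_field_derivative F * f z) (at z)" "(g has_field_derivative G * g z) (at z)"
  shows "((\<lambda>z. f z * g z :: complex) has_field_derivative (F + G) * (f z * g z)) (at z)"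
  by (rule DERIV_cong[OF DERIV_mult[OF assms]]) (simp add: algebra_simps)

lemma log_deriv_divide:
  assumes "(f has_field_derivative F * f z) (at z)" "(g has_field_derivative G * g z) (at z)" "g z \<noteq> 0"
  shows "((\<lambda>z. f z / g z :: complex) has_field_derivative (F - G) * (f z / g z)) (at z)"
proof -
  have "(F * f z * g z - f z * (G * g z)) / (g z * g z) = (F - G) * (f z / g z)"
    using assms(3) by (simp add: field_simps)
  thus ?thesis using DERIV_divide[OF assms] by simp
qed

lemma log_deriv_power:
  assumes "(f has_field_derivative F * f z) (at z)"
  shows "((\<lambda>z. f z ^ n :: complex) has_field_derivative (of_nat n * F) * f z ^ n) (at z)"
  by (rule DERIV_cong[OF DERIV_power[OF assms]]) (cases n; simp add: algebra_simps)

lemma log_deriv_exp: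
  assumes "(f has_field_derivative F) (at z)"
  shows "((\<lambda>z. exp (f z) :: complex) has_field_derivative F * exp (f z)) (at z)"
  by (rule DERIV_cong[OF DERIV_fun_exp[OF assms]]) (rule mult.commute)

lemma log_deriv_shift:
  assumes "(f has_field_derivative F * f (a + z)) (at (a + z))"
  shows "((\<lambda>z. f (a + z) :: complex) has_field_derivative F * f (a + z)) (at z)"
proof -
  have "((\<lambda>z. a + z) has_field_derivative 1) (at z)" by (auto intro!: derivative_eq_intros)
  from DERIV_chain2[of f, OF assms this] show ?thesis by simp
qed

lemma log_deriv_reflect:
  assumes "(f has_field_derivative F * f (a - z)) (at (a - z))"
  shows "((\<lambda>z. f (a - z) :: complex) has_field_derivative (- F) * f (a - z)) (at z)"
proof -
  have "((\<lambda>z. a - z) has_field_derivative - 1) (at z)" by (auto intro!: derivative_eq_intros)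
  from DERIV_chain2[of f, OF assms this] show ?thesis by simp
qed

text \<open>For nonzero \<open>x\<close> in \<open>half_Int_Compl\<close> this is 4 x - 8 pi x^2 /
  sin (2 pi x). The digamma form also makes sense at 0 and matches the series of the partial
  products.\<close>

definition log_deriv_limit :: "complex \<Rightarrow> complex" where
  "log_deriv_limit x = 4 * x\<^sup>2 * ((Digamma (1 + x) - Digamma (1 - x)) - (Digamma (1 / 2 + x) - Digamma (1 / 2 - x)))"

text \<open>This is \<open>Digamma_reflection\<close> at \<open>1 / 2 - x\<close>. It expresses the
  contribution of the cosine factor through digamma values.\<close>

lemma Digamma_half_reflection:
  assumes x: "x \<in> half_Int_Compl"
  shows "Digamma (1 / 2 + x) - Digamma (1 / 2 - x) = of_real pi * tan (of_real pi * x)"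
proof -
  have "1 / 2 - x \<notin> \<int>"
  proof
    assume *: "1 / 2 - x \<in> \<int>"
    have "1 - 2 * (1 / 2 - x) \<in> \<int>" by (intro Ints_diff[OF _ Ints_mult[OF _ *]]) auto
    hence "2 * x \<in> \<int>" by simp
    hence "x = 0" using x by (simp add: half_Int_Compl_def)
    with * show False using fraction_not_in_Ints[of 2 1, where 'a = complex] by simp
  qed
  from Digamma_reflection[OF this] have
    "Digamma (1 / 2 + x) - Digamma (1 / 2 - x) = of_real pi * cot (of_real pi * (1 / 2 - x))"
    by (simp only: diff_diff_eq2 diff_add_eq[symmetric]) (simp add: add.commute)
  also have "of_real pi * (1 / 2 - x) = of_real pi / 2 - of_real pi * x"
    by (simp add: algebra_simps)
  also have "cot (of_real pi / 2 - of_real pi * x) = tan (of_real pi * x)"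
    by (simp add: cot_def tan_def sin_diff cos_diff)
  finally show ?thesis .
qed

definition rhs_product :: "(nat \<Rightarrow> complex \<Rightarrow> complex) \<Rightarrow> complex \<Rightarrow> complex" where
  "rhs_product \<Gamma> x = cos (of_real pi * x) / of_real pi
      * exp (2 * x ^ 2 + 7 * zeta 3 / (2 * of_real pi ^ 2))
      * (Barnes_G \<Gamma> (1 + x) * Barnes_G \<Gamma> (1 - x)) ^ 4
      * ((\<Gamma> 3 (1 - x) * \<Gamma> 3 (1 + x)) / (\<Gamma> 3 (3 / 2 - x) * \<Gamma> 3 (3 / 2 + x))) ^ 8"

text \<open>Add the logarithmic derivatives of the factors and reduce all of them to digamma values
  at 1 + x, 1 - x, 1/2 + x and 1/2 - x. The unknown constants of \<Gamma>_2 and \<Gamma>_3 cancel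
  because the arguments come in pairs a + x, a - x.\<close>

lemma rhs_product_log_deriv:
  assumes fam: "multiple_Gamma_family \<Gamma>" and x: "x \<in> half_Int_Compl"
  shows "(rhs_product \<Gamma> has_field_derivative log_deriv_limit x * rhs_product \<Gamma> x) (at x)"
    and "rhs_product \<Gamma> x \<noteq> 0"
proof -
  obtain c where G2: "\<And>z. z \<notin> \<int>\<^sub>\<le>\<^sub>0 \<Longrightarrow> (\<Gamma> 2 has_field_derivative - ((z - 1) * Digamma z - z + c) * \<Gamma> 2 z) (at z)"
    "\<And>z. z \<notin> \<int>\<^sub>\<le>\<^sub>0 \<Longrightarrow> \<Gamma> 2 z \<noteq> 0"
    using multiple_Gamma_2_log_deriv[OF fam] by metis
  obtain b d where G3: "\<And>z. z \<notin> \<int>\<^sub>\<le>\<^sub>0 \<Longrightarrow> (\<Gamma> 3 has_field_derivative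
       ((z - 1) * (z - 2) / 2 * Digamma z - 3 / 4 * z\<^sup>2 + b * z + d) * \<Gamma> 3 z) (at z)"
    "\<And>z. z \<notin> \<int>\<^sub>\<le>\<^sub>0 \<Longrightarrow> \<Gamma> 3 z \<noteq> 0"
    using multiple_Gamma_3_log_deriv[OF fam] by metis
  define g where "g = (\<lambda>z. (z - 1) * Digamma z - z + c)"
  define h where "h = (\<lambda>z. (z - 1) * (z - 2) / 2 * Digamma z - 3 / 4 * z\<^sup>2 + b * z + d)"
  note sh = half_Int_Compl_shift[OF x]
  have cos: "((\<lambda>x. cos (of_real pi * x) / of_real pi) has_field_derivative
      (- of_real pi * tan (of_real pi * x)) * (cos (of_real pi * x) / of_real pi)) (at x)"
    using cos_pi_nonzero[OF x]
    by (auto intro!: derivative_eq_intros simp: tan_def)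
  have ex: "((\<lambda>x. exp (2 * x ^ 2 + 7 * zeta 3 / (2 * of_real pi ^ 2))) has_field_derivative
      4 * x * exp (2 * x ^ 2 + 7 * zeta 3 / (2 * of_real pi ^ 2))) (at x)"
    by (auto intro!: derivative_eq_intros)
  have bar: "(Barnes_G \<Gamma> has_field_derivative g z * Barnes_G \<Gamma> z) (at z)" if "z \<notin> \<int>\<^sub>\<le>\<^sub>0" for z
    unfolding Barnes_G_def [abs_def] g_def
    by (rule derivative_eq_intros G2 that refl)+ (use G2(2)[OF that] in \<open>auto simp: field_simps\<close>)
  have G3': "(\<Gamma> 3 has_field_derivative h z * \<Gamma> 3 z) (at z)" if "z \<notin> \<int>\<^sub>\<le>\<^sub>0" for z
    using G3(1)[OF that] by (simp add: h_def)
  have "(rhs_product \<Gamma> has_field_derivative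
     (- of_real pi * tan (of_real pi * x) + 4 * x + of_nat 4 * (g (1 + x) + (- g (1 - x)))
       + of_nat 8 * ((- h (1 - x) + h (1 + x)) - (- h (3/2 - x) + h (3/2 + x)))) * rhs_product \<Gamma> x) (at x)"
    unfolding rhs_product_def[abs_def]
    by (intro log_deriv_mult log_deriv_divide log_deriv_power cos ex log_deriv_shift log_deriv_reflect bar G3' sh)
      (use G3(2) sh in auto)
  moreover have "- of_real pi * tan (of_real pi * x) + 4 * x + of_nat 4 * (g (1 + x) + (- g (1 - x)))
       + of_nat 8 * ((- h (1 - x) + h (1 + x)) - (- h (3/2 - x) + h (3/2 + x))) = log_deriv_limit x"
  proof -
    have nz: "1 / 2 + x \<noteq> 0" "1 / 2 - x \<noteq> 0" using sh(3,4) by (metis zero_in_nonpos_Ints)+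
    have a: "Digamma (3/2 + x) = Digamma (1/2 + x) + 1 / (1/2 + x)"
      using Digamma_plus1[OF nz(1)] by (simp add: add_ac field_simps)
    have b: "Digamma (3/2 - x) = Digamma (1/2 - x) + 1 / (1/2 - x)"
      using Digamma_plus1[OF nz(2)] by (simp add: add_ac field_simps)
    \<comment> \<open>At z = 3/2 + x and z = 3/2 - x the factor z - 1 of \<open>h\<close> removes
      the pole that moving \<open>Digamma\<close> from z to z - 1 produces.\<close>
    have cancel: "u * v / 2 * (B + 1 / u) = u * v / 2 * B + v / 2" if "u \<noteq> 0" for u v B :: complex
      using that by (simp add: field_simps)
    have ha: "h (3/2 + x) = (x\<^sup>2 - 1/4) / 2 * Digamma (1/2 + x) + (x - 1/2) / 2 - 3 / 4 * (3/2 + x)\<^sup>2 + b * (3/2 + x) + d"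
    proof -
      have "(3/2 + x - 1) * (3/2 + x - 2) = (1/2 + x) * (x - 1/2)" "x\<^sup>2 - 1/4 = (1/2 + x) * (x - 1/2)"
        by (simp_all add: power2_eq_square algebra_simps)
      thus ?thesis unfolding h_def a using cancel[OF nz(1), of "x - 1/2" "Digamma (1/2 + x)"] by metis
    qed
    have hb: "h (3/2 - x) = (x\<^sup>2 - 1/4) / 2 * Digamma (1/2 - x) + (- x - 1/2) / 2 - 3 / 4 * (3/2 - x)\<^sup>2 + b * (3/2 - x) + d"
    proof -
      have "(3/2 - x - 1) * (3/2 - x - 2) = (1/2 - x) * (- x - 1/2)" "x\<^sup>2 - 1/4 = (1/2 - x) * (- x - 1/2)"
        by (simp_all add: power2_eq_square algebra_simps)
      thus ?thesis unfolding h_def b using cancel[OF nz(2), of "- x - 1/2" "Digamma (1/2 - x)"] by metis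
    qed
    have tan: "- of_real pi * tan (of_real pi * x) = - (Digamma (1/2 + x) - Digamma (1/2 - x))"
      by (simp add: Digamma_half_reflection[OF x])
    \<comment> \<open>With the digamma values replaced by variables, what remains is a polynomial
      identity.\<close>
    have ring: "- (B1 - B2) + 4 * x + 4 * ((1 + x - 1) * A1 - (1+x) + c + - ((1 - x - 1)*A2 - (1-x) + c))
      + 8 * (- ((1 - x - 1) * (1 - x - 2) / 2 * A2 - 3 / 4 * (1-x)\<^sup>2 + b * (1-x) + d)
        + ((1 + x - 1) * (1 + x - 2) / 2 * A1 - 3 / 4 * (1+x)\<^sup>2 + b * (1+x) + d)
        - (- ((x\<^sup>2 - 1/4) / 2 * B2 + (- x - 1/2) / 2 - 3 / 4 * (3/2 - x)\<^sup>2 + b * (3/2 - x) + d)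
          + ((x\<^sup>2 - 1/4) / 2 * B1 + (x - 1/2) / 2 - 3 / 4 * (3/2 + x)\<^sup>2 + b * (3/2 + x) + d)))
      = 4 * x\<^sup>2 * ((A1 - A2) - (B1 - B2))" for A1 A2 B1 B2 :: complex
      by (simp add: power2_eq_square algebra_simps add_divide_distrib diff_divide_distrib)
    show ?thesis unfolding ha hb tan log_deriv_limit_def of_nat_numeral
      unfolding g_def h_def by (rule ring)
  qed
  ultimately show "(rhs_product \<Gamma> has_field_derivative log_deriv_limit x * rhs_product \<Gamma> x) (at x)" by simp
  show "rhs_product \<Gamma> x \<noteq> 0"
    using cos_pi_nonzero[OF x] G2(2) G3(2) sh by (simp add: rhs_product_def Barnes_G_def)
qed

section \<open>Convergence of the partial products\<close>

lemma log_deriv_power_int: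
  assumes "(f has_field_derivative F * f z) (at z)" "f z \<noteq> 0"
  shows "((\<lambda>z. f z powi n :: complex) has_field_derivative (of_int n * F) * f z powi n) (at z)"
proof (rule DERIV_cong[OF DERIV_power_int[OF assms(1) disjI2[OF assms(2)]]])
  have "f z powi n = f z powi (n - 1) * f z"
    using power_int_add_1[of "f z" "n - 1"] assms(2) by simp
  thus "of_int n * f z powi (n - 1) * (F * f z) = of_int n * F * f z powi n" by simp
qed

definition lhs_product :: "nat \<Rightarrow> complex \<Rightarrow> complex" where
  "lhs_product N x = (\<Prod>k=1..2*N. (1 - 4 * x ^ 2 / of_nat k ^ 2) powi (- (int k ^ 2) * (-1) ^ k))"

lemma square_neq_half_Int:
  assumes "x \<in> half_Int_Compl" "c \<noteq> 0" "2 * c \<in> \<int>"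
  shows "c\<^sup>2 - x\<^sup>2 \<noteq> 0"
proof
  assume "c\<^sup>2 - x\<^sup>2 = 0"
  hence "c\<^sup>2 = x\<^sup>2" by simp
  hence "c = x \<or> c = - x" unfolding power2_eq_iff .
  thus False using assms by (auto simp: half_Int_Compl_def minus_in_Ints_iff)
qed

text \<open>The joint contribution of the factors \<open>k = 2 * j + 1\<close> and
  \<open>k = 2 * j + 2\<close>, written with the nodes k/2. The pairing is what makes the series
  converge.\<close>

definition log_deriv_term :: "nat \<Rightarrow> complex \<Rightarrow> complex" where
  "log_deriv_term j x = 4 * x\<^sup>2 * (2 * x / ((1 + of_nat j)\<^sup>2 - x\<^sup>2) - 2 * x / ((1 / 2 + of_nat j)\<^sup>2 - x\<^sup>2))"

lemma node_nonzero: "1 + of_nat j \<noteq> (0 :: complex)" "1 / 2 + of_nat j \<noteq> (0 :: complex)"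
proof -
  show "1 + of_nat j \<noteq> (0 :: complex)" using of_nat_neq_0[of j, where 'a = complex] by simp
  have "Re (1 / 2 + of_nat j) > 0" by (simp add: add_pos_nonneg)
  thus "1 / 2 + of_nat j \<noteq> (0 :: complex)" by (metis less_irrefl zero_complex.simps(1))
qed

lemma node_Ints: "2 * (1 + of_nat j) \<in> (\<int> :: complex set)" "2 * (1 / 2 + of_nat j) \<in> (\<int> :: complex set)"
proof -
  have "2 * (1 + of_nat j) = (of_nat (2 * j + 2) :: complex)" "2 * (1 / 2 + of_nat j) = (of_nat (2 * j + 1) :: complex)"
    by (simp_all add: algebra_simps)
  thus "2 * (1 + of_nat j) \<in> (\<int> :: complex set)" "2 * (1 / 2 + of_nat j) \<in> (\<int> :: complex set)"
    using Ints_of_nat by metis+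
qed

text \<open>With w = k/2 the factor \<open>k\<close> contributes 8 x w^2 / (w^2 - x^2), with a plus
  sign for even and a minus sign for odd \<open>k\<close>. This equals 8 x + 8 x^3 / (w^2 - x^2) up
  to that sign, and the parts 8 x cancel within each pair.\<close>

lemma lhs_product_log_deriv:
  assumes x: "x \<in> half_Int_Compl"
  shows "(lhs_product N has_field_derivative (\<Sum>j<N. log_deriv_term j x) * lhs_product N x) (at x)"
proof -
  define e where "e = (\<lambda>k. - (int k ^ 2) * (-1) ^ k)"
  define F where "F = (\<lambda>k::nat. - 8 * x / (of_nat k ^ 2 - 4 * x\<^sup>2))"
  have nz: "of_nat k ^ 2 - 4 * x\<^sup>2 \<noteq> (0 :: complex)" if "k \<ge> 1" for k
    using square_neq_half_Int[OF x, of "of_nat k / 2"] that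
    by (simp add: power2_eq_square field_simps)
  have nz': "1 - 4 * x ^ 2 / of_nat k ^ 2 \<noteq> 0" if "k \<ge> 1" for k
    using nz[OF that] that by (simp add: field_simps)
  have f: "((\<lambda>x. 1 - 4 * x ^ 2 / of_nat k ^ 2) has_field_derivative F k * (1 - 4 * x ^ 2 / of_nat k ^ 2)) (at x)"
    if "k \<ge> 1" for k
  proof -
    have k: "of_nat k \<noteq> (0 :: complex)" using that by simp
    have "((\<lambda>x. 1 - q * x ^ 2) has_field_derivative - (q * (2 * x))) (at x)" for q :: complex
      by (auto intro!: derivative_eq_intros)
    from this[of "4 / of_nat k ^ 2"] have "((\<lambda>x. 1 - 4 * x ^ 2 / of_nat k ^ 2) has_field_derivative - 8 * x / of_nat k ^ 2) (at x)"
      by simp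
    moreover have "- 8 * x / of_nat k ^ 2 = F k * (1 - 4 * x ^ 2 / of_nat k ^ 2)"
    proof -
      have "1 - 4 * x ^ 2 / of_nat k ^ 2 = (of_nat k ^ 2 - 4 * x\<^sup>2) / of_nat k ^ 2"
        using k by (simp add: diff_divide_distrib)
      thus ?thesis using nz[OF that] by (simp add: F_def)
    qed
    ultimately show ?thesis by simp
  qed
  have eq: "lhs_product N = (\<lambda>x. \<Prod>k=1..2*N. (1 - 4 * x ^ 2 / of_nat k ^ 2) powi e k)"
    by (simp add: lhs_product_def e_def fun_eq_iff)
  have "(lhs_product N has_field_derivative lhs_product N x *
      (\<Sum>k=1..2*N. (of_int (e k) * F k * (1 - 4 * x ^ 2 / of_nat k ^ 2) powi e k) /
          (1 - 4 * x ^ 2 / of_nat k ^ 2) powi e k)) (at x)"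
    unfolding eq
  proof (rule has_field_derivative_prod')
    fix k assume "k \<in> {1..2*N}"
    hence k: "k \<ge> 1" by simp
    show "(1 - 4 * x ^ 2 / of_nat k ^ 2) powi e k \<noteq> 0" by (intro power_int_not_zero disjI1 nz' k)
    show "((\<lambda>x. (1 - 4 * x ^ 2 / of_nat k ^ 2) powi e k) has_field_derivative
        of_int (e k) * F k * (1 - 4 * x ^ 2 / of_nat k ^ 2) powi e k) (at x)"
      by (rule log_deriv_power_int[OF f[OF k] nz'[OF k]])
  qed
  also have "(\<Sum>k=1..2*N. (of_int (e k) * F k * (1 - 4 * x ^ 2 / of_nat k ^ 2) powi e k) /
          (1 - 4 * x ^ 2 / of_nat k ^ 2) powi e k) = (\<Sum>k=1..2*N. of_int (e k) * F k)"
    by (intro sum.cong refl nonzero_mult_div_cancel_right power_int_not_zero disjI1 nz') auto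
  also have "\<dots> = (\<Sum>j<N. log_deriv_term j x)"
  proof (induction N)
    case (Suc N)
    define u :: complex where "u = 1 + of_nat N"
    define v :: complex where "v = 1 / 2 + of_nat N"
    have uv: "u\<^sup>2 - x\<^sup>2 \<noteq> 0" "v\<^sup>2 - x\<^sup>2 \<noteq> 0"
      unfolding u_def v_def by (intro square_neq_half_Int x node_nonzero node_Ints)+
    have F: "F k = - 2 * x / (w\<^sup>2 - x\<^sup>2)" if "of_nat k = 2 * w" for k w
    proof -
      have "- 8 * x / (4 * d) = - 2 * x / d" for d :: complex by simp
      moreover have "of_nat k ^ 2 - 4 * x\<^sup>2 = 4 * (w\<^sup>2 - x\<^sup>2)"
        unfolding that by (simp add: power2_eq_square)
      ultimately show ?thesis unfolding F_def by metis
    qed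
    have 1: "of_int (e (Suc (2 * N))) * F (Suc (2 * N)) = - 8 * x * (v\<^sup>2 / (v\<^sup>2 - x\<^sup>2))"
    proof -
      have "of_nat (Suc (2 * N)) = 2 * v" "of_int (e (Suc (2 * N))) = 4 * v\<^sup>2"
        by (simp_all add: e_def v_def power2_eq_square algebra_simps)
      thus ?thesis by (simp only: F) simp
    qed
    have 2: "of_int (e (Suc (Suc (2 * N)))) * F (Suc (Suc (2 * N))) = 8 * x * (u\<^sup>2 / (u\<^sup>2 - x\<^sup>2))"
    proof -
      have "of_nat (Suc (Suc (2 * N))) = 2 * u" "of_int (e (Suc (Suc (2 * N)))) = - 4 * u\<^sup>2"
        by (simp_all add: e_def u_def power2_eq_square algebra_simps)
      thus ?thesis by (simp only: F) simp
    qed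
    have "u\<^sup>2 / (u\<^sup>2 - x\<^sup>2) = 1 + x\<^sup>2 / (u\<^sup>2 - x\<^sup>2)" "v\<^sup>2 / (v\<^sup>2 - x\<^sup>2) = 1 + x\<^sup>2 / (v\<^sup>2 - x\<^sup>2)"
      using uv by (simp_all add: field_simps)
    hence "of_int (e (Suc (2 * N))) * F (Suc (2 * N)) + of_int (e (Suc (Suc (2 * N)))) * F (Suc (Suc (2 * N)))
        = log_deriv_term N x"
      unfolding 1 2 log_deriv_term_def u_def[symmetric] v_def[symmetric]
      by (simp add: algebra_simps power2_eq_square)
    thus ?case using Suc.IH by simp
  qed simp
  finally show ?thesis by (simp add: mult.commute)
qed

lemma log_deriv_term_sums:
  assumes "x \<in> half_Int_Compl"
  shows "(\<lambda>j. log_deriv_term j x) sums log_deriv_limit x"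
  unfolding log_deriv_term_def log_deriv_limit_def
  by (intro sums_mult sums_diff Digamma_diff_sums half_Int_Compl_shift assms)

text \<open>Since |x| is at most |c|/2, the denominator has modulus at least |c|^2 / 2.\<close>

lemma norm_inverse_square_diff_le:
  fixes x c :: complex
  assumes "norm x \<le> M" "2 * M \<le> norm c" "M > 0"
  shows "norm (2 * x / (c\<^sup>2 - x\<^sup>2)) \<le> 4 * M / (norm c)\<^sup>2"
proof -
  have "(norm x)\<^sup>2 \<le> M\<^sup>2" using assms by (intro power_mono) auto
  moreover have "4 * M\<^sup>2 \<le> (norm c)\<^sup>2"
    using power_mono[of "2 * M" "norm c" 2] assms by (simp add: power_mult_distrib)
  moreover have "norm (c\<^sup>2) - norm (x\<^sup>2) \<le> norm (c\<^sup>2 - x\<^sup>2)" by (rule norm_triangle_ineq2)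
  moreover have "M\<^sup>2 \<ge> 0" by simp
  ultimately have *: "(norm c)\<^sup>2 / 2 \<le> norm (c\<^sup>2 - x\<^sup>2)"
    unfolding norm_power by linarith
  have c: "norm c > 0" using assms by linarith
  have "norm (2 * x / (c\<^sup>2 - x\<^sup>2)) = 2 * norm x / norm (c\<^sup>2 - x\<^sup>2)" by (simp add: norm_divide norm_mult)
  also have "\<dots> \<le> 2 * M / ((norm c)\<^sup>2 / 2)"
    using * assms c by (intro frac_le) auto
  finally show ?thesis by simp
qed

lemma log_deriv_term_bound:
  assumes "norm x \<le> M" "M > 0" "2 * M \<le> real j"
  shows "norm (log_deriv_term j x) \<le> 32 * M ^ 3 / real j ^ 2"
proof -
  have j: "real j > 0" using assms by linarith
  have *: "norm (2 * x / ((a + of_nat j)\<^sup>2 - x\<^sup>2)) \<le> 4 * M / (real j)\<^sup>2" if "a = of_real b" "b \<ge> 0" for a :: complex and b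
  proof -
    have n: "norm (a + of_nat j) = b + real j"
      using that by (metis abs_of_nonneg norm_of_real of_real_add of_real_of_nat_eq add_nonneg_nonneg of_nat_0_le_iff)
    have "norm (2 * x / ((a + of_nat j)\<^sup>2 - x\<^sup>2)) \<le> 4 * M / (norm (a + of_nat j))\<^sup>2"
      by (rule norm_inverse_square_diff_le) (use assms n that in auto)
    also have "\<dots> \<le> 4 * M / (real j)\<^sup>2"
      unfolding n using assms j that by (intro divide_left_mono power_mono) auto
    finally show ?thesis .
  qed
  have "norm (log_deriv_term j x) = 4 * (norm x)\<^sup>2 *
      norm (2 * x / ((1 + of_nat j)\<^sup>2 - x\<^sup>2) - 2 * x / ((1 / 2 + of_nat j)\<^sup>2 - x\<^sup>2))"
    by (simp add: log_deriv_term_def norm_mult norm_power)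
  also have "\<dots> \<le> 4 * M\<^sup>2 * (4 * M / (real j)\<^sup>2 + 4 * M / (real j)\<^sup>2)"
    using assms *[of 1 1] *[of "1/2" "1/2"]
    by (intro mult_mono power_mono order_trans[OF norm_triangle_ineq4] add_mono) auto
  also have "\<dots> = 32 * M ^ 3 / real j ^ 2" by (simp add: power2_eq_square power3_eq_cube)
  finally show ?thesis .
qed

text \<open>Weierstrass test with the bound of order 1/j^2 from \<open>log_deriv_term_bound\<close>;
  on the ball |x| is at most \<open>M\<close>, and the bound is available once j \<ge> 2 M.\<close>

lemma log_deriv_term_uniform:
  assumes "z \<in> half_Int_Compl"
  shows "\<exists>r>0. uniform_limit (ball z r) (\<lambda>N x. (\<Sum>j<N. log_deriv_term j x) - log_deriv_limit x) (\<lambda>_. 0) sequentially"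
proof -
  obtain r where r: "r > 0" "ball z r \<subseteq> half_Int_Compl"
    using open_half_Int_Compl assms by (meson open_contains_ball)
  define M where "M = norm z + r"
  have M: "M > 0" using r by (simp add: M_def add_nonneg_pos)
  have "uniform_limit (ball z r) (\<lambda>N x. \<Sum>j<N. log_deriv_term j x) (\<lambda>x. \<Sum>j. log_deriv_term j x) sequentially"
  proof (rule Weierstrass_m_test_ev)
    show "\<forall>\<^sub>F j in sequentially. \<forall>x\<in>ball z r. norm (log_deriv_term j x) \<le> 32 * M ^ 3 * (1 / real j ^ 2)"
      using eventually_ge_at_top[of "nat \<lceil>2 * M\<rceil>"]
    proof eventually_elim
      case (elim j)
      show ?case
      proof
        fix x assume "x \<in> ball z r"
        hence "norm x \<le> M" using norm_triangle_ineq2[of x z] by (auto simp: M_def dist_norm norm_minus_commute)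
        thus "norm (log_deriv_term j x) \<le> 32 * M ^ 3 * (1 / real j ^ 2)"
          using log_deriv_term_bound[of x M j] M elim by simp
      qed
    qed
    show "summable (\<lambda>j. 32 * M ^ 3 * (1 / real j ^ 2))"
      using inverse_power_summable[of 2, where 'a = real] by (intro summable_mult) (simp add: field_simps)
  qed
  hence "uniform_limit (ball z r) (\<lambda>N x. \<Sum>j<N. log_deriv_term j x) log_deriv_limit sequentially"
    by (rule uniform_limit_cong'[THEN iffD1, rotated -1])
       (use r log_deriv_term_sums in \<open>auto simp: sums_iff\<close>)
  from uniform_limit_minus[OF this uniform_limit_const]
  have "uniform_limit (ball z r) (\<lambda>N x. (\<Sum>j<N. log_deriv_term j x) - log_deriv_limit x)
      (\<lambda>x. log_deriv_limit x - log_deriv_limit x) sequentially" .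
  thus ?thesis using r by auto
qed

lemma log_deriv_limit_holomorphic: "log_deriv_limit holomorphic_on half_Int_Compl"
  unfolding log_deriv_limit_def[abs_def] using half_Int_Compl_shift
  by (intro holomorphic_intros holomorphic_on_compose_gen[unfolded o_def, of _ _ Digamma "- \<int>\<^sub>\<le>\<^sub>0"]
        holomorphic_on_Polygamma) auto

lemma log_deriv_term_holomorphic: "log_deriv_term j holomorphic_on half_Int_Compl"
  unfolding log_deriv_term_def[abs_def]
  by (intro holomorphic_intros square_neq_half_Int node_nonzero node_Ints) auto

text \<open>Apply \<open>log_deriv_tendsto\<close> to the quotient of the two sides with base point
  0, where the partial products are 1. The value of the right-hand side at 0 is found in
  \<open>rhs_product_0\<close>.\<close>

lemma lhs_product_tendsto:
  assumes fam: "multiple_Gamma_family \<Gamma>" and x: "x \<in> half_Int_Compl"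
  shows "(\<lambda>N. lhs_product N x) \<longlonglongrightarrow> rhs_product \<Gamma> x / rhs_product \<Gamma> 0"
proof -
  have 0: "0 \<in> half_Int_Compl" by (simp add: half_Int_Compl_def)
  note R = rhs_product_log_deriv[OF fam]
  have "(\<lambda>N. lhs_product N x / rhs_product \<Gamma> x) \<longlonglongrightarrow> 1 / rhs_product \<Gamma> 0"
  proof (rule log_deriv_tendsto[where a = 0 and f = "\<lambda>N x. lhs_product N x / rhs_product \<Gamma> x"
        and E = "\<lambda>N x. (\<Sum>j<N. log_deriv_term j x) - log_deriv_limit x", OF open_half_Int_Compl connected_half_Int_Compl])
    show "((\<lambda>x. lhs_product N x / rhs_product \<Gamma> x) has_field_derivative
        ((\<Sum>j<N. log_deriv_term j z) - log_deriv_limit z) * (lhs_product N z / rhs_product \<Gamma> z)) (at z)"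
      if "z \<in> half_Int_Compl" for N z
      by (intro log_deriv_divide lhs_product_log_deriv R that)
    show "(\<lambda>x. (\<Sum>j<N. log_deriv_term j x) - log_deriv_limit x) holomorphic_on half_Int_Compl" for N
      by (intro holomorphic_intros log_deriv_term_holomorphic log_deriv_limit_holomorphic)
    show "(\<lambda>N. lhs_product N 0 / rhs_product \<Gamma> 0) \<longlonglongrightarrow> 1 / rhs_product \<Gamma> 0"
      by (simp add: lhs_product_def)
  qed (use 0 x log_deriv_term_uniform in auto)
  from tendsto_mult[OF this tendsto_const[of "rhs_product \<Gamma> x"]] show ?thesis
    using R(2)[OF x] by simp
qed

section \<open>An antiderivative on the upper half-plane\<close>

definition chi_coeff :: "nat \<Rightarrow> nat \<Rightarrow> complex" where
  "chi_coeff s n = (if odd n then 1 / of_nat n ^ s else 0)"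

text \<open>The sum over odd indices is encoded as a full power series with zero even coefficients,
  so that the theory of power series applies. Index 0 is even, so its term is 0.\<close>

definition legendre_chi :: "nat \<Rightarrow> complex \<Rightarrow> complex" where
  "legendre_chi s z = (\<Sum>n. chi_coeff s n * z ^ n)"

lemma norm_chi_coeff_le: "norm (chi_coeff s n) \<le> 1"
proof -
  have "1 \<le> real n ^ s" if "odd n" using that by (intro one_le_power) (auto elim: oddE)
  thus ?thesis by (auto simp: chi_coeff_def norm_divide norm_power divide_simps)
qed

lemma summable_legendre_chi:
  assumes "norm z < 1"
  shows "summable (\<lambda>n. chi_coeff s n * z ^ n)"
proof (rule summable_comparison_test')
  show "summable (\<lambda>n. norm z ^ n)" using assms by (intro summable_geometric) auto
  show "norm (chi_coeff s n * z ^ n) \<le> norm z ^ n" for n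
    using mult_right_mono[OF norm_chi_coeff_le, of "norm z ^ n" s n] by (simp add: norm_mult norm_power)
qed

text \<open>Termwise differentiation lowers the order \<open>s\<close> by one. The product form
  \<open>z * D\<close> avoids a division at \<open>z = 0\<close>.\<close>

lemma legendre_chi_deriv:
  assumes z: "norm z < 1"
  obtains D where "(legendre_chi (Suc s) has_field_derivative D) (at z)" "z * D = legendre_chi s z"
proof
  obtain r where r: "norm z < r" "r < 1" using z dense by blast
  have "r \<ge> 0" using r norm_ge_zero[of z] by linarith
  hence "norm (complex_of_real r) < 1" "norm z < norm (complex_of_real r)" using r by auto
  thus D: "(legendre_chi (Suc s) has_field_derivative (\<Sum>n. diffs (chi_coeff (Suc s)) n * z ^ n)) (at z)"
    unfolding legendre_chi_def[abs_def]
    by (intro termdiffs_strong[of _ "of_real r"] summable_legendre_chi) auto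
  have "summable (\<lambda>n. diffs (chi_coeff (Suc s)) n * z ^ n)"
    using z summable_legendre_chi by (intro termdiff_converges[of z 1]) auto
  from diffs_equiv[OF this]
  have "(\<lambda>n. of_nat n * chi_coeff (Suc s) n * z ^ (n - Suc 0)) sums (\<Sum>n. diffs (chi_coeff (Suc s)) n * z ^ n)" .
  from sums_mult[OF this, of z]
  have "(\<lambda>n. z * (of_nat n * chi_coeff (Suc s) n * z ^ (n - Suc 0))) sums (z * (\<Sum>n. diffs (chi_coeff (Suc s)) n * z ^ n))" .
  moreover have "z * (of_nat n * chi_coeff (Suc s) n * z ^ (n - Suc 0)) = chi_coeff s n * z ^ n" for n
    by (cases n) (auto simp: chi_coeff_def divide_simps simp del: of_nat_Suc)
  ultimately show "z * (\<Sum>n. diffs (chi_coeff (Suc s)) n * z ^ n) = legendre_chi s z"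
    by (simp add: legendre_chi_def sums_iff)
qed

text \<open>In the difference of the two logarithm series the even terms cancel and the odd ones
  double.\<close>

lemma legendre_chi_1:
  assumes z: "norm z < 1"
  shows "2 * legendre_chi 1 z = Ln (1 + z) - Ln (1 - z)"
proof -
  have "(\<lambda>n. (-1) ^ Suc n / of_nat n * z ^ n - (-1) ^ Suc n / of_nat n * (-z) ^ n) sums (Ln (1 + z) - Ln (1 + (- z)))"
    using z by (intro sums_diff Ln_series) auto
  moreover have "(-1) ^ Suc n / of_nat n * z ^ n - (-1) ^ Suc n / of_nat n * (-z) ^ n = 2 * (chi_coeff 1 n * z ^ n)" for n
    by (cases "even n") (auto simp: chi_coeff_def power_minus_odd)
  ultimately have "(\<lambda>n. 2 * (chi_coeff 1 n * z ^ n)) sums (Ln (1 + z) - Ln (1 - z))" by simp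
  moreover have "(\<lambda>n. 2 * (chi_coeff 1 n * z ^ n)) sums (2 * legendre_chi 1 z)"
    unfolding legendre_chi_def by (intro sums_mult summable_sums summable_legendre_chi z)
  ultimately show ?thesis using sums_unique2 by blast
qed

lemma chi_term_bound:
  assumes "norm z \<le> 1"
  shows "norm (chi_coeff s n * z ^ n) \<le> 1 / real n ^ s"
proof -
  have "norm (chi_coeff s n) \<le> 1 / real n ^ s" by (simp add: chi_coeff_def norm_divide norm_power)
  moreover have "norm (z ^ n) \<le> 1" using assms by (simp add: norm_power power_le_one)
  ultimately show ?thesis using mult_mono[of "norm (chi_coeff s n)" "1 / real n ^ s" "norm (z ^ n)" 1]
    by (simp add: norm_mult)
qed

lemma summable_one_over_power: "s \<ge> 2 \<Longrightarrow> summable (\<lambda>n. 1 / real n ^ s)"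
  using inverse_power_summable[of s, where 'a = real] by (simp add: field_simps)

text \<open>For s \<ge> 2 the series converges uniformly on the closed disc, so the limits at the
  boundary points 1 and -1 can be taken inside.\<close>

lemma legendre_chi_continuous:
  assumes "s \<ge> 2"
  shows "continuous_on (cball 0 1) (legendre_chi s)"
  unfolding legendre_chi_def[abs_def]
  by (rule uniform_limit_theorem[OF _ Weierstrass_m_test[where M = "\<lambda>n. 1 / real n ^ s"]])
    (use chi_term_bound summable_one_over_power[OF assms] in
      \<open>auto intro!: always_eventually continuous_intros\<close>)

lemma legendre_chi_minus:
  assumes "s \<ge> 2" "norm z \<le> 1"
  shows "legendre_chi s (- z) = - legendre_chi s z"
proof -
  have "summable (\<lambda>n. chi_coeff s n * z ^ n)"
    by (rule summable_comparison_test'[OF summable_one_over_power[OF assms(1)] chi_term_bound[OF assms(2)]])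
  moreover have "chi_coeff s n * (- z) ^ n = - (chi_coeff s n * z ^ n)" for n
    by (simp add: chi_coeff_def power_minus_odd)
  ultimately show ?thesis unfolding legendre_chi_def by (simp add: suminf_minus)
qed

text \<open>The series starts at 0 here, where the term 1 / 0 is 0.\<close>

lemma zeta_3_sums: "(\<lambda>n. 1 / of_nat n ^ 3) sums zeta 3"
proof -
  have "(1 :: complex) / of_nat (Suc k) powr 3 = 1 / of_nat (Suc k) ^ 3" for k
    using powr_nat'[of "of_nat (Suc k) :: complex" 3] by (simp del: of_nat_Suc)
  hence "zeta 3 = (\<Sum>k. 1 / of_nat (Suc k) ^ 3)" unfolding zeta_def by (simp del: of_nat_Suc)
  moreover have "summable (\<lambda>n. 1 / of_nat n ^ 3 :: complex)"
    using inverse_power_summable[of 3, where 'a = complex] by (simp add: field_simps)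
  hence "(\<lambda>n. 1 / of_nat (Suc n) ^ 3 :: complex) sums (\<Sum>k. 1 / of_nat (Suc k) ^ 3)"
    by (subst (asm) summable_Suc_iff[symmetric]) (rule summable_sums)
  ultimately show ?thesis by (subst (asm) sums_Suc_iff) simp
qed

lemma zeta_3_real: "zeta 3 = of_real (Re (zeta 3))"
proof -
  have "(\<lambda>n. Im (1 / of_nat n ^ 3)) sums Im (zeta 3)" by (rule sums_Im[OF zeta_3_sums])
  moreover have "Im (1 / of_nat n ^ 3) = 0" for n
    by (metis Im_complex_of_real of_real_divide of_real_1 of_real_of_nat_eq of_real_power)
  ultimately have "Im (zeta 3) = 0" by (simp add: sums_iff)
  thus ?thesis by (simp add: complex_eq_iff)
qed

text \<open>The even indices contribute one eighth of the full series.\<close>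

lemma legendre_chi_3_1: "legendre_chi 3 1 = 7 / 8 * zeta 3"
proof -
  have "(\<lambda>n. if even n then 1 / of_nat n ^ 3 else 0 :: complex) sums (zeta 3 / 8)"
  proof -
    have "(\<lambda>n. 1 / 8 * (1 / of_nat n ^ 3) :: complex) sums (1 / 8 * zeta 3)" by (intro sums_mult zeta_3_sums)
    moreover have "1 / 8 * (1 / of_nat n ^ 3) = (if even (2 * n) then 1 / of_nat (2 * n) ^ 3 else 0 :: complex)" for n
      by (simp add: power_mult_distrib)
    ultimately have "(\<lambda>n. if even (2 * n) then 1 / of_nat (2 * n) ^ 3 else 0 :: complex) sums (zeta 3 / 8)" by simp
    thus ?thesis
      by (subst (asm) sums_mono_reindex[of "\<lambda>n. 2 * n"]) (auto simp: strict_mono_def elim!: evenE)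
  qed
  from sums_diff[OF zeta_3_sums this]
  have "(\<lambda>n. 1 / of_nat n ^ 3 - (if even n then 1 / of_nat n ^ 3 else 0)) sums (7 / 8 * zeta 3)" by simp
  moreover have "1 / of_nat n ^ 3 - (if even n then 1 / of_nat n ^ 3 else 0) = chi_coeff 3 n * 1 ^ n" for n
    by (simp add: chi_coeff_def)
  ultimately show ?thesis by (simp add: legendre_chi_def sums_iff)
qed

text \<open>The coordinate q = exp (2 pi i t) sends the upper half-plane into the unit disc; t
  \<rightarrow> 0 becomes q \<rightarrow> 1, and t \<rightarrow> 1/2 becomes q \<rightarrow>
  -1.\<close>

definition nome :: "complex \<Rightarrow> complex" where
  "nome t = exp (2 * of_real pi * \<i> * t)"

text \<open>Since \<open>tan (\<pi> t) = i (1 - q) / (1 + q)\<close>, this is \<open>ln (tan (\<pi> t))\<close> up to an additive constant.\<close>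
definition ln_tan_pi :: "complex \<Rightarrow> complex" where
  "ln_tan_pi t = Ln (1 - nome t) - Ln (1 + nome t)"

text \<open>The antiderivative of \<open>8 \<pi> t\<^sup>2 / sin (2 \<pi> t)\<close> obtained by integrating by parts twice.\<close>
definition Phi :: "complex \<Rightarrow> complex" where
  "Phi t = 4 * t\<^sup>2 * ln_tan_pi t - 8 * \<i> / of_real pi * t * legendre_chi 2 (nome t)
     + 4 / of_real pi ^ 2 * legendre_chi 3 (nome t)"

lemma norm_nome: "Im t > 0 \<Longrightarrow> norm (nome t) < 1"
  by (simp add: nome_def mult_pos_pos)

lemma upper_half_plane_subset: "Im t > 0 \<Longrightarrow> t \<in> half_Int_Compl"
  by (auto simp: half_Int_Compl_def elim!: Ints_cases dest!: arg_cong[of _ _ Im])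

lemma nome_deriv: "(nome has_field_derivative 2 * of_real pi * \<i> * nome t) (at t)"
  unfolding nome_def[abs_def] by (auto intro!: derivative_eq_intros)

lemma ln_tan_pi_deriv:
  assumes "Im t > 0"
  shows "(ln_tan_pi has_field_derivative - 4 * of_real pi * \<i> * nome t / (1 - nome t ^ 2)) (at t)"
proof -
  have n: "norm (nome t) < 1" using norm_nome[OF assms] .
  \<comment> \<open>Both logarithms are evaluated in the right half-plane, away from the branch
    cut.\<close>
  have r: "Re (1 - nome t) > 0" "Re (1 + nome t) > 0"
    using abs_Re_le_cmod[of "nome t"] n by auto
  hence nr: "1 - nome t \<notin> \<real>\<^sub>\<le>\<^sub>0" "1 + nome t \<notin> \<real>\<^sub>\<le>\<^sub>0"
    by (auto simp: complex_nonpos_Reals_iff)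
  have nz: "1 - nome t \<noteq> 0" "1 + nome t \<noteq> 0" using nr by auto
  have "(ln_tan_pi has_field_derivative (- (2 * of_real pi * \<i> * nome t)) / (1 - nome t) - 2 * of_real pi * \<i> * nome t / (1 + nome t)) (at t)"
    unfolding ln_tan_pi_def[abs_def] using nr
    by (auto intro!: derivative_eq_intros nome_deriv simp: field_simps)
  moreover have "(- (2 * of_real pi * \<i> * q)) / (1 - q) - 2 * of_real pi * \<i> * q / (1 + q) =
      - 4 * of_real pi * \<i> * q / (1 - q ^ 2)" if "1 - q \<noteq> 0" "1 + q \<noteq> 0" for q
  proof -
    have "1 - q ^ 2 = (1 - q) * (1 + q)" by (simp add: power2_eq_square algebra_simps)
    thus ?thesis using that by (simp add: field_simps)
  qed
  ultimately show ?thesis using nz by simp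
qed

lemma legendre_chi_nome_deriv:
  assumes "Im t > 0"
  shows "((\<lambda>t. legendre_chi (Suc s) (nome t)) has_field_derivative 2 * of_real pi * \<i> * legendre_chi s (nome t)) (at t)"
proof -
  obtain D where D: "(legendre_chi (Suc s) has_field_derivative D) (at (nome t))" "nome t * D = legendre_chi s (nome t)"
    using legendre_chi_deriv[OF norm_nome[OF assms]] by blast
  show ?thesis
    by (rule DERIV_cong[OF DERIV_chain2[OF D(1) nome_deriv]]) (simp add: D(2)[symmetric])
qed

text \<open>Each derivative of a chi function of the nome is 2 pi i times the one of lower order,
  and \<open>ln_tan_pi\<close> is -2 times the one of order 1. All terms cancel except the one that
  differentiates \<open>ln_tan_pi\<close>.\<close>

lemma Phi_deriv:
  assumes t: "Im t > 0"
  shows "(Phi has_field_derivative - 16 * of_real pi * \<i> * t\<^sup>2 * nome t / (1 - nome t ^ 2)) (at t)"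
proof -
  define d where "d = - 4 * of_real pi * \<i> * nome t / (1 - nome t ^ 2)"
  have L: "ln_tan_pi t = - 2 * legendre_chi 1 (nome t)"
    using legendre_chi_1[OF norm_nome[OF t]] by (simp add: ln_tan_pi_def)
  have gen: "((\<lambda>t. 4 * t\<^sup>2 * L t - A * t * X t + B * Y t) has_field_derivative
      8 * t * L t + 4 * t\<^sup>2 * l - (A * X t + A * t * x) + B * y) (at t)"
    if "(L has_field_derivative l) (at t)" "(X has_field_derivative x) (at t)" "(Y has_field_derivative y) (at t)"
    for L X Y :: "complex \<Rightarrow> complex" and A B l x y
    using that by (auto intro!: derivative_eq_intros simp: algebra_simps)
  have "(Phi has_field_derivative 8 * t * ln_tan_pi t + 4 * t\<^sup>2 * d - (8 * \<i> / of_real pi * legendre_chi 2 (nome t)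
      + 8 * \<i> / of_real pi * t * (2 * of_real pi * \<i> * legendre_chi 1 (nome t)))
      + 4 / of_real pi ^ 2 * (2 * of_real pi * \<i> * legendre_chi 2 (nome t))) (at t)"
    unfolding Phi_def[abs_def] d_def
    using ln_tan_pi_deriv[OF t] legendre_chi_nome_deriv[OF t, of 1] legendre_chi_nome_deriv[OF t, of 2]
    by (intro gen) (simp_all add: eval_nat_numeral)
  moreover have "8 * t * ln_tan_pi t + 4 * t\<^sup>2 * d - (8 * \<i> / of_real pi * legendre_chi 2 (nome t)
      + 8 * \<i> / of_real pi * t * (2 * of_real pi * \<i> * legendre_chi 1 (nome t)))
      + 4 / of_real pi ^ 2 * (2 * of_real pi * \<i> * legendre_chi 2 (nome t)) = 4 * t\<^sup>2 * d"
    unfolding L by (simp add: field_simps power2_eq_square)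
  moreover have "4 * t\<^sup>2 * d = - 16 * of_real pi * \<i> * t\<^sup>2 * nome t / (1 - nome t ^ 2)"
    by (simp add: d_def)
  ultimately show ?thesis by (simp only:)
qed

text \<open>The second summand is \<open>- 8 \<pi> t\<^sup>2 / sin (2 \<pi> t)\<close>.\<close>
lemma log_deriv_limit_upper:
  assumes t: "Im t > 0"
  shows "log_deriv_limit t = 4 * t + 16 * of_real pi * \<i> * t\<^sup>2 * nome t / (1 - nome t ^ 2)"
proof -
  have D: "t \<in> half_Int_Compl" using t by (rule upper_half_plane_subset)
  have t0: "t \<noteq> 0" "t \<notin> \<int>" using t by (auto elim!: Ints_cases)
  \<comment> \<open>A square root of the nome, which turns cotangent and tangent into rational
    functions.\<close>
  define w where "w = exp (\<i> * (of_real pi * t))"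
  have w: "w \<noteq> 0" "nome t = w\<^sup>2"
    by (auto simp: w_def nome_def exp_double[symmetric] power2_eq_square exp_add[symmetric] algebra_simps)
  have sc: "sin (of_real pi * t) = (w - inverse w) / (2 * \<i>)" "cos (of_real pi * t) = (w + inverse w) / 2"
    by (simp_all add: sin_exp_eq cos_exp_eq w_def exp_minus)
  have "sin (of_real pi * t) \<noteq> 0" using t0 by (auto simp: sin_eq_0 mult_ac)
  moreover have "cos (of_real pi * t) \<noteq> 0" by (rule cos_pi_nonzero[OF D])
  ultimately have "w - inverse w \<noteq> 0" "w + inverse w \<noteq> 0" using sc by auto
  hence nz: "w\<^sup>2 - 1 \<noteq> 0" "w\<^sup>2 + 1 \<noteq> 0" using w by (auto simp: field_simps power2_eq_square)
  have A: "Digamma (1 + t) - Digamma (1 - t) = 1 / t - of_real pi * cot (of_real pi * t)"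
    using Digamma_plus1[OF t0(1)] Digamma_reflection[OF t0(2)] by (simp add: add.commute algebra_simps)
  have "cot (of_real pi * t) = \<i> * (w\<^sup>2 + 1) / (w\<^sup>2 - 1)" "tan (of_real pi * t) = - \<i> * (w\<^sup>2 - 1) / (w\<^sup>2 + 1)"
  proof -
    have e: "w + inverse w = (w\<^sup>2 + 1) / w" "w - inverse w = (w\<^sup>2 - 1) / w"
      using w by (simp_all add: field_simps power2_eq_square)
    have "(u / w / 2) / (v / w / (2 * \<i>)) = \<i> * u / v" "(v / w / (2 * \<i>)) / (u / w / 2) = - \<i> * v / u"
      if "u \<noteq> 0" "v \<noteq> 0" for u v
      using w(1) that by (simp_all add: field_simps)
    thus "cot (of_real pi * t) = \<i> * (w\<^sup>2 + 1) / (w\<^sup>2 - 1)" "tan (of_real pi * t) = - \<i> * (w\<^sup>2 - 1) / (w\<^sup>2 + 1)"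
      unfolding cot_def tan_def sc e using nz by blast+
  qed
  hence "cot (of_real pi * t) + tan (of_real pi * t) = \<i> * (w\<^sup>2 + 1) / (w\<^sup>2 - 1) - \<i> * (w\<^sup>2 - 1) / (w\<^sup>2 + 1)" by simp
  also have "\<dots> = 4 * \<i> * w\<^sup>2 / ((w\<^sup>2 - 1) * (w\<^sup>2 + 1))"
    using nz by (simp add: divide_simps) (simp add: algebra_simps power2_eq_square)
  also have "(w\<^sup>2 - 1) * (w\<^sup>2 + 1) = - (1 - nome t ^ 2)"
    by (simp add: w algebra_simps power2_eq_square)
  finally have ct: "cot (of_real pi * t) + tan (of_real pi * t) = - (4 * \<i> * nome t / (1 - nome t ^ 2))"
    unfolding w(2)[symmetric] minus_divide_right .
  have "log_deriv_limit t = 4 * t\<^sup>2 * (1 / t) - 4 * t\<^sup>2 * of_real pi * (cot (of_real pi * t) + tan (of_real pi * t))"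
    unfolding log_deriv_limit_def A Digamma_half_reflection[OF D] by (simp add: algebra_simps)
  also have "4 * t\<^sup>2 * (1 / t) = 4 * t" using t0 by (simp add: power2_eq_square)
  finally show ?thesis unfolding ct by simp
qed

text \<open>On the connected upper half-plane \<open>rhs_product\<close> and exp (2 t^2 -
  \<open>Phi t\<close>) have the same logarithmic derivative.\<close>

lemma rhs_product_upper_const:
  assumes fam: "multiple_Gamma_family \<Gamma>" and "Im a > 0" "Im b > 0"
  shows "rhs_product \<Gamma> a * exp (Phi a - 2 * a\<^sup>2) = rhs_product \<Gamma> b * exp (Phi b - 2 * b\<^sup>2)"
proof -
  have "rhs_product \<Gamma> a / exp (2 * a\<^sup>2 - Phi a) = rhs_product \<Gamma> b / exp (2 * b\<^sup>2 - Phi b)"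
  proof (rule log_deriv_ratio_constant[of "{t. Im t > 0}" _ log_deriv_limit])
    show "open {t. Im t > 0}" by (rule open_halfspace_Im_gt)
    show "connected {t. Im t > 0}" by (intro convex_connected convex_halfspace_Im_gt)
    show "(rhs_product \<Gamma> has_field_derivative log_deriv_limit t * rhs_product \<Gamma> t) (at t)"
      if "t \<in> {t. Im t > 0}" for t
      using rhs_product_log_deriv(1)[OF fam upper_half_plane_subset] that by simp
    show "((\<lambda>t. exp (2 * t\<^sup>2 - Phi t)) has_field_derivative log_deriv_limit t * exp (2 * t\<^sup>2 - Phi t)) (at t)"
      if "t \<in> {t. Im t > 0}" for t
    proof (rule log_deriv_exp)
      have t: "Im t > 0" using that by simp
      show "((\<lambda>t. 2 * t\<^sup>2 - Phi t) has_field_derivative log_deriv_limit t) (at t)"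
        unfolding log_deriv_limit_upper[OF t]
        by (rule derivative_eq_intros Phi_deriv t refl | simp)+
    qed
  qed (use assms in auto)
  thus ?thesis by (simp add: exp_diff field_simps)
qed

section \<open>The constant of proportionality\<close>

lemma legendre_chi_tendsto_1:
  assumes "s \<ge> 2"
  shows "((\<lambda>e. legendre_chi s (of_real (exp (- 2 * pi * e)))) \<longlongrightarrow> legendre_chi s 1) (at_right 0)"
proof (rule continuous_on_tendsto_compose[OF legendre_chi_continuous[OF assms]])
  have "((\<lambda>e. complex_of_real (exp (- 2 * pi * e))) \<longlongrightarrow> of_real (exp (- 2 * pi * 0))) (at_right 0)"
    by (intro tendsto_intros)
  thus "((\<lambda>e. complex_of_real (exp (- 2 * pi * e))) \<longlongrightarrow> 1) (at_right 0)" by simp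
  show "\<forall>\<^sub>F e in at_right 0. complex_of_real (exp (- 2 * pi * e)) \<in> cball 0 1"
    using eventually_at_right_less[of "0::real"] by eventually_elim (auto simp: mult_nonneg_nonneg)
qed auto

text \<open>The coefficients are real. Hence the exponential of an imaginary multiple of
  \<open>legendre_chi 2 1\<close> has modulus 1 in \<open>rhs_product_0\<close>.\<close>

lemma Im_legendre_chi_1: "s \<ge> 2 \<Longrightarrow> Im (legendre_chi s 1) = 0"
proof -
  assume s: "s \<ge> 2"
  have "summable (\<lambda>n. chi_coeff s n * 1 ^ n)"
    by (rule summable_comparison_test'[OF summable_one_over_power[OF s] chi_term_bound]) simp
  hence "(\<lambda>n. Im (chi_coeff s n * 1 ^ n)) sums Im (legendre_chi s 1)"
    unfolding legendre_chi_def by (intro sums_Im summable_sums)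
  moreover have "Im (1 / of_nat n ^ s) = 0" for n
    by (metis Im_complex_of_real of_real_divide of_real_1 of_real_of_nat_eq of_real_power)
  hence "Im (chi_coeff s n * 1 ^ n) = 0" for n by (simp add: chi_coeff_def)
  ultimately show ?thesis by (simp add: sums_iff)
qed

text \<open>For e > 0 this is ln (tanh (pi e)), split as in \<open>ln_tan_pi\<close>.\<close>

definition ln_tanh_pi :: "real \<Rightarrow> real" where
  "ln_tanh_pi e = ln (1 - exp (- 2 * pi * e)) - ln (1 + exp (- 2 * pi * e))"

lemma nome_imaginary: "nome (\<i> * of_real e) = of_real (exp (- 2 * pi * e))"
proof -
  have "2 * of_real pi * \<i> * (\<i> * of_real e) = of_real (- 2 * pi * e)" by simp
  thus ?thesis unfolding nome_def by (simp only: exp_of_real)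
qed

lemma nome_half_imaginary: "nome (1 / 2 + \<i> * of_real e) = - of_real (exp (- 2 * pi * e))"
proof -
  have "2 * of_real pi * \<i> * (1 / 2 + \<i> * of_real e) = \<i> * of_real pi + of_real (- 2 * pi * e)"
    by (simp add: algebra_simps)
  thus ?thesis unfolding nome_def by (simp only: exp_add exp_of_real exp_pi_i' mult_minus1)
qed

lemma ln_tan_pi_imaginary:
  assumes "e > 0"
  shows "ln_tan_pi (\<i> * of_real e) = of_real (ln_tanh_pi e)" "ln_tan_pi (1 / 2 + \<i> * of_real e) = - of_real (ln_tanh_pi e)"
proof -
  define r where "r = exp (- 2 * pi * e)"
  have r: "0 < r" "r < 1" using assms by (auto simp: r_def)
  have "Ln (1 - of_real r) = of_real (ln (1 - r))" "Ln (1 + of_real r) = of_real (ln (1 + r))"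
    using Ln_of_real[of "1 - r"] Ln_of_real[of "1 + r"] r by auto
  thus "ln_tan_pi (\<i> * of_real e) = of_real (ln_tanh_pi e)" "ln_tan_pi (1 / 2 + \<i> * of_real e) = - of_real (ln_tanh_pi e)"
    unfolding ln_tan_pi_def nome_imaginary nome_half_imaginary ln_tanh_pi_def r_def[symmetric] by simp_all
qed

lemma ln_tanh_pi_limits:
  "((\<lambda>e. e * ln_tanh_pi e) \<longlongrightarrow> 0) (at_right 0)"
  "((\<lambda>e. e\<^sup>2 * ln_tanh_pi e) \<longlongrightarrow> 0) (at_right 0)"
  unfolding ln_tanh_pi_def by real_asymp+

text \<open>The expression is -sinh (pi e) / tanh (pi e) = -cosh (pi e). Here the zero of the cosine
  factor at 1/2 meets the singularity of exp (\<open>Phi\<close>).\<close>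

lemma ln_tanh_pi_limit_exp:
  "((\<lambda>e. (exp (- (pi * e)) - exp (pi * e)) / 2 * exp (- ln_tanh_pi e)) \<longlongrightarrow> - 1) (at_right 0)"
proof -
  have "((\<lambda>e. (exp (- (pi * e)) - exp (pi * e)) / 2 * ((1 + exp (- 2 * pi * e)) / (1 - exp (- 2 * pi * e)))) \<longlongrightarrow> - 1) (at_right 0)"
    by (real_asymp simp: field_simps)
  moreover have "\<forall>\<^sub>F e in at_right (0::real). (exp (- (pi * e)) - exp (pi * e)) / 2 * ((1 + exp (- 2 * pi * e)) / (1 - exp (- 2 * pi * e)))
      = (exp (- (pi * e)) - exp (pi * e)) / 2 * exp (- ln_tanh_pi e)"
    using eventually_at_right_less[of "0::real"]
  proof eventually_elim
    case (elim e)
    have "exp (- ln_tanh_pi e) = (1 + exp (- 2 * pi * e)) / (1 - exp (- 2 * pi * e))"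
      using elim by (simp add: ln_tanh_pi_def exp_diff add_pos_pos)
    thus ?case by (simp only:)
  qed
  ultimately show ?thesis by (rule tendsto_cong[THEN iffD1, rotated])
qed

text \<open>At 0 the factor t^2 absorbs the logarithmic singularity, and only the chi function of
  order 3 survives in \<open>Phi\<close>; its value at 1 brings in zeta (3).\<close>

lemma rhs_product_Phi_tendsto_0:
  assumes fam: "multiple_Gamma_family \<Gamma>"
  shows "((\<lambda>e. rhs_product \<Gamma> (\<i> * of_real e) * exp (Phi (\<i> * of_real e) - 2 * (\<i> * of_real e)\<^sup>2)) \<longlongrightarrow>
      rhs_product \<Gamma> 0 * exp (7 * zeta 3 / (2 * of_real pi ^ 2))) (at_right 0)"
proof -
  have "isCont (rhs_product \<Gamma>) 0"
    using DERIV_isCont[OF rhs_product_log_deriv(1)[OF fam, of 0]] by (simp add: half_Int_Compl_def)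
  moreover have path: "((\<lambda>e. \<i> * complex_of_real e) \<longlongrightarrow> \<i> * of_real 0) (at_right 0)" by (intro tendsto_intros)
  ultimately have R: "((\<lambda>e. rhs_product \<Gamma> (\<i> * of_real e)) \<longlongrightarrow> rhs_product \<Gamma> 0) (at_right 0)"
    by (intro isCont_tendsto_compose[of _ "rhs_product \<Gamma>"]) simp_all
  have ev: "\<forall>\<^sub>F e in at_right 0. - 4 * of_real (e\<^sup>2 * ln_tanh_pi e) - 8 * \<i> / of_real pi * (\<i> * of_real e) * legendre_chi 2 (of_real (exp (- 2 * pi * e)))
     + 4 / of_real pi ^ 2 * legendre_chi 3 (of_real (exp (- 2 * pi * e))) - 2 * (\<i> * of_real e)\<^sup>2 =
     Phi (\<i> * of_real e) - 2 * (\<i> * of_real e)\<^sup>2"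
    using eventually_at_right_less[of "0::real"]
  proof eventually_elim
    case (elim e)
    have "4 * (\<i> * of_real e)\<^sup>2 * complex_of_real (ln_tanh_pi e) = - 4 * of_real (e\<^sup>2 * ln_tanh_pi e)"
      by (simp add: power_mult_distrib)
    thus ?case unfolding Phi_def nome_imaginary ln_tan_pi_imaginary(1)[OF elim] by (simp only:)
  qed
  have "((\<lambda>e. - 4 * of_real (e\<^sup>2 * ln_tanh_pi e) - 8 * \<i> / of_real pi * (\<i> * of_real e) * legendre_chi 2 (of_real (exp (- 2 * pi * e)))
     + 4 / of_real pi ^ 2 * legendre_chi 3 (of_real (exp (- 2 * pi * e))) - 2 * (\<i> * of_real e)\<^sup>2) \<longlongrightarrow>
     - 4 * of_real 0 - 8 * \<i> / of_real pi * (\<i> * of_real 0) * legendre_chi 2 1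
     + 4 / of_real pi ^ 2 * legendre_chi 3 1 - 2 * (\<i> * of_real 0)\<^sup>2) (at_right 0)"
    by (intro tendsto_intros ln_tanh_pi_limits legendre_chi_tendsto_1) auto
  hence "((\<lambda>e. Phi (\<i> * of_real e) - 2 * (\<i> * of_real e)\<^sup>2) \<longlongrightarrow> 4 / of_real pi ^ 2 * legendre_chi 3 1) (at_right 0)"
    by (subst (asm) tendsto_cong[OF ev]) simp
  moreover have "4 / of_real pi ^ 2 * legendre_chi 3 1 = 7 * zeta 3 / (2 * of_real pi ^ 2)"
    by (simp add: legendre_chi_3_1)
  ultimately have "((\<lambda>e. Phi (\<i> * of_real e) - 2 * (\<i> * of_real e)\<^sup>2) \<longlongrightarrow> 7 * zeta 3 / (2 * of_real pi ^ 2)) (at_right 0)"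
    by simp
  thus ?thesis by (intro tendsto_mult R tendsto_exp)
qed

text \<open>The recurrences at 1 and 1/2, with \<open>Gamma (1 / 2)\<close> the square root of pi.
  They leave \<Gamma>_2 (1/2) and \<Gamma>_3 (3/2) as the only unknowns at x = 1/2.\<close>

lemma multiple_Gamma_special_values:
  assumes fam: "multiple_Gamma_family \<Gamma>"
  shows "\<Gamma> 3 2 = 1" "\<Gamma> 3 (1 / 2) = \<Gamma> 3 (3 / 2) * \<Gamma> 2 (1 / 2)"
    "(1 / \<Gamma> 2 (3 / 2) * (1 / \<Gamma> 2 (1 / 2))) ^ 4 = of_real pi ^ 2 / \<Gamma> 2 (1 / 2) ^ 8"
proof -
  have 1: "(1 :: complex) \<notin> \<int>\<^sub>\<le>\<^sub>0" "(1 / 2 :: complex) \<notin> \<int>\<^sub>\<le>\<^sub>0"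
    using pos_real_not_nonpos_Int[of 1, where 'a = complex] pos_real_not_nonpos_Int[of "1/2", where 'a = complex] by auto
  have G1: "\<Gamma> 1 = Gamma" using fam by (simp add: multiple_Gamma_family_def)
  have nz: "\<Gamma> 2 (1 / 2) \<noteq> 0" using multiple_Gamma_pos[OF fam, of 2 "1/2"] by auto
  show "\<Gamma> 3 2 = 1"
    using multiple_Gamma_rec[OF fam, of 2 1] 1 multiple_Gamma_1[OF fam, of 2] multiple_Gamma_1[OF fam, of 3]
    by simp
  show "\<Gamma> 3 (1 / 2) = \<Gamma> 3 (3 / 2) * \<Gamma> 2 (1 / 2)"
    using multiple_Gamma_rec[OF fam, of 2 "1/2"] 1 nz by (simp add: field_simps)
  have "\<Gamma> 2 (3 / 2) = \<Gamma> 2 (1 / 2) / Gamma (1 / 2)"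
    using multiple_Gamma_rec[OF fam, of 1 "1/2"] 1 by (simp add: G1[unfolded One_nat_def] numeral_2_eq_2)
  moreover have "Gamma (1 / 2 :: complex) ^ 4 = of_real pi ^ 2"
  proof -
    have "Gamma (1 / 2 :: complex) = of_real (sqrt pi)" by (rule Gamma_one_half_complex)
    hence "Gamma (1 / 2 :: complex) ^ 2 = of_real pi" by (simp add: of_real_power[symmetric] del: of_real_power)
    thus ?thesis by (metis mult_2 numeral_Bit0 power_add power2_eq_square)
  qed
  ultimately show "(1 / \<Gamma> 2 (3 / 2) * (1 / \<Gamma> 2 (1 / 2))) ^ 4 = of_real pi ^ 2 / \<Gamma> 2 (1 / 2) ^ 8"
    using nz by (simp add: power_divide power_mult_distrib flip: power_add)
qed

text \<open>The cosine vanishes at 1/2 while exp (\<open>Phi\<close>) has a simple singularity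
  there, so the product has a finite limit. The powers of \<Gamma>_2 (1/2) cancel, and \<Gamma>_3
  (3/2) is the only unknown left.\<close>

lemma rhs_product_Phi_tendsto_half:
  assumes fam: "multiple_Gamma_family \<Gamma>"
  defines "Z \<equiv> 7 * zeta 3 / (2 * of_real pi ^ 2)"
  shows "((\<lambda>e. rhs_product \<Gamma> (1 / 2 + \<i> * of_real e) * exp (Phi (1 / 2 + \<i> * of_real e) - 2 * (1 / 2 + \<i> * of_real e)\<^sup>2)) \<longlongrightarrow>
      of_real pi * exp Z * \<Gamma> 3 (3 / 2) ^ 16 * (- \<i>) * exp (4 * \<i> / of_real pi * legendre_chi 2 1 - Z)) (at_right 0)"
proof -
  define T where "T = (\<lambda>e. 1 / 2 + \<i> * complex_of_real e)"
  have T: "(T \<longlongrightarrow> 1 / 2) (at_right 0)"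
  proof -
    have "(T \<longlongrightarrow> 1 / 2 + \<i> * complex_of_real 0) (at_right 0)" unfolding T_def by (intro tendsto_intros)
    thus ?thesis by simp
  qed
  have pos: "complex_of_real y \<notin> \<int>\<^sub>\<le>\<^sub>0" if "y > 0" for y using pos_real_not_nonpos_Int that by blast
  have nz: "\<Gamma> n (of_real y) \<noteq> 0" if "y > 0" "n \<ge> 1" for n y
    using multiple_Gamma_pos[OF fam that(2,1)] by auto
  have G: "((\<lambda>e. \<Gamma> n (g e)) \<longlongrightarrow> \<Gamma> n (of_real y)) (at_right 0)"
    if "(g \<longlongrightarrow> of_real y) (at_right (0::real))" "y > 0" "n \<ge> 1" for g n y
  proof -
    have "\<Gamma> n holomorphic_on - \<int>\<^sub>\<le>\<^sub>0" by (rule multiple_Gamma_holomorphic[OF fam that(3)])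
    hence "continuous_on (- \<int>\<^sub>\<le>\<^sub>0) (\<Gamma> n)" by (rule holomorphic_on_imp_continuous_on)
    hence "isCont (\<Gamma> n) (of_real y)"
      using pos[OF that(2)] by (simp add: continuous_on_eq_continuous_at open_Compl)
    thus ?thesis using that(1) by (rule isCont_tendsto_compose)
  qed
  have lims: "((\<lambda>e. 1 + T e) \<longlongrightarrow> of_real (3/2)) (at_right 0)" "((\<lambda>e. 1 - T e) \<longlongrightarrow> of_real (1/2)) (at_right 0)"
    "((\<lambda>e. 3 / 2 + T e) \<longlongrightarrow> of_real 2) (at_right 0)" "((\<lambda>e. 3 / 2 - T e) \<longlongrightarrow> of_real 1) (at_right 0)"
    using tendsto_add[OF tendsto_const[of 1] T] tendsto_diff[OF tendsto_const[of 1] T]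
      tendsto_add[OF tendsto_const[of "3/2"] T] tendsto_diff[OF tendsto_const[of "3/2"] T] by simp_all
  \<comment> \<open>The right-hand side without its cosine, which is continuous at 1/2.\<close>
  define R1 where "R1 = (\<lambda>x. 1 / of_real pi * exp (2 * x ^ 2 + Z)
      * (1 / \<Gamma> 2 (1 + x) * (1 / \<Gamma> 2 (1 - x))) ^ 4
      * ((\<Gamma> 3 (1 - x) * \<Gamma> 3 (1 + x)) / (\<Gamma> 3 (3 / 2 - x) * \<Gamma> 3 (3 / 2 + x))) ^ 8)"
  have "((\<lambda>e. R1 (T e)) \<longlongrightarrow> 1 / of_real pi * exp (2 * (1 / 2) ^ 2 + Z)
      * (1 / \<Gamma> 2 (of_real (3/2)) * (1 / \<Gamma> 2 (of_real (1/2)))) ^ 4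
      * ((\<Gamma> 3 (of_real (1/2)) * \<Gamma> 3 (of_real (3/2))) / (\<Gamma> 3 (of_real 1) * \<Gamma> 3 (of_real 2))) ^ 8) (at_right 0)"
    unfolding R1_def by (intro tendsto_intros G lims T no_zero_divisors nz) auto
  also have "1 / of_real pi * exp (2 * (1 / 2) ^ 2 + Z)
      * (1 / \<Gamma> 2 (of_real (3/2)) * (1 / \<Gamma> 2 (of_real (1/2)))) ^ 4
      * ((\<Gamma> 3 (of_real (1/2)) * \<Gamma> 3 (of_real (3/2))) / (\<Gamma> 3 (of_real 1) * \<Gamma> 3 (of_real 2))) ^ 8
      = of_real pi * exp Z * exp (1 / 2) * \<Gamma> 3 (3 / 2) ^ 16"
  proof -
    have e: "exp (2 * (1 / 2) ^ 2 + Z) = exp Z * exp (1 / 2)" by (simp add: exp_add power2_eq_square)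
    have c: "complex_of_real (3/2) = 3/2" "complex_of_real (1/2) = 1/2" "complex_of_real 1 = 1" "complex_of_real 2 = 2"
      by simp_all
    have "(c * g * c) ^ 8 = c ^ 16 * g ^ 8" for c g :: complex
      by (simp add: power_mult_distrib flip: power_add)
    moreover have "\<Gamma> 2 (1 / 2) \<noteq> 0" using nz[of "1/2" 2] by simp
    ultimately show ?thesis
      unfolding e c multiple_Gamma_special_values[OF fam] multiple_Gamma_1[OF fam, of 3, simplified]
      by (simp add: field_simps power2_eq_square)
  qed
  finally have R1: "((\<lambda>e. R1 (T e)) \<longlongrightarrow> of_real pi * exp Z * exp (1 / 2) * \<Gamma> 3 (3 / 2) ^ 16) (at_right 0)" .
  \<comment> \<open>With t = 1/2 + i e one has 4 t^2 = 1 + 4 i e - 4 e^2. The leading 1 yields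
    \<open>exp (- ln_tanh_pi e)\<close>, grouped with the cosine; the other two terms are the
    vanishing limits of \<open>ln_tanh_pi_limits\<close>.\<close>
  have main: "rhs_product \<Gamma> (T e) * exp (Phi (T e) - 2 * (T e)\<^sup>2) =
      R1 (T e) * (\<i> * of_real ((exp (- (pi * e)) - exp (pi * e)) / 2 * exp (- ln_tanh_pi e)))
      * exp (- 4 * \<i> * of_real (e * ln_tanh_pi e) + 4 * of_real (e\<^sup>2 * ln_tanh_pi e))
      * exp (8 * \<i> / of_real pi * T e * legendre_chi 2 (of_real (exp (- 2 * pi * e)))
        - 4 / of_real pi ^ 2 * legendre_chi 3 (of_real (exp (- 2 * pi * e))) - 2 * (T e)\<^sup>2)"
    if e: "e > 0" for e
  proof -
    define r where "r = complex_of_real (exp (- 2 * pi * e))"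
    define X where "X = 8 * \<i> / of_real pi * T e * legendre_chi 2 r - 4 / of_real pi ^ 2 * legendre_chi 3 r"
    have cos: "cos (of_real pi * T e) = \<i> * of_real ((exp (- (pi * e)) - exp (pi * e)) / 2)"
      by (rule complex_eqI) (simp_all add: Re_cos Im_cos T_def)
    have R: "rhs_product \<Gamma> (T e) = cos (of_real pi * T e) * R1 (T e)"
      by (simp add: rhs_product_def R1_def Barnes_G_def Z_def)
    have "norm r \<le> 1" using e by (simp add: r_def)
    note chi = legendre_chi_minus[OF _ this]
    have "4 * (T e)\<^sup>2 * - of_real (ln_tanh_pi e) = of_real (- ln_tanh_pi e) + (- 4 * \<i> * of_real (e * ln_tanh_pi e) + 4 * of_real (e\<^sup>2 * ln_tanh_pi e))"
      by (simp add: T_def power2_eq_square algebra_simps)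
    moreover have "Phi (T e) = 4 * (T e)\<^sup>2 * - of_real (ln_tanh_pi e) + X"
      unfolding Phi_def T_def nome_half_imaginary ln_tan_pi_imaginary(2)[OF e] X_def r_def[symmetric]
      by (simp add: chi)
    ultimately have "Phi (T e) - 2 * (T e)\<^sup>2 = of_real (- ln_tanh_pi e) +
        (- 4 * \<i> * of_real (e * ln_tanh_pi e) + 4 * of_real (e\<^sup>2 * ln_tanh_pi e)) + (X - 2 * (T e)\<^sup>2)"
      by simp
    hence "exp (Phi (T e) - 2 * (T e)\<^sup>2) = of_real (exp (- ln_tanh_pi e)) *
        exp (- 4 * \<i> * of_real (e * ln_tanh_pi e) + 4 * of_real (e\<^sup>2 * ln_tanh_pi e)) * exp (X - 2 * (T e)\<^sup>2)"
      by (simp only: exp_add exp_of_real)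
    thus ?thesis unfolding R cos r_def[symmetric] X_def[symmetric] by (simp only: of_real_mult mult_ac)
  qed
  have "((\<lambda>e. R1 (T e) * (\<i> * of_real ((exp (- (pi * e)) - exp (pi * e)) / 2 * exp (- ln_tanh_pi e)))
      * exp (- 4 * \<i> * of_real (e * ln_tanh_pi e) + 4 * of_real (e\<^sup>2 * ln_tanh_pi e))
      * exp (8 * \<i> / of_real pi * T e * legendre_chi 2 (of_real (exp (- 2 * pi * e)))
        - 4 / of_real pi ^ 2 * legendre_chi 3 (of_real (exp (- 2 * pi * e))) - 2 * (T e)\<^sup>2)) \<longlongrightarrow>
      (of_real pi * exp Z * exp (1 / 2) * \<Gamma> 3 (3 / 2) ^ 16) * (\<i> * of_real (- 1))
      * exp (- 4 * \<i> * of_real 0 + 4 * of_real 0)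
      * exp (8 * \<i> / of_real pi * (1 / 2) * legendre_chi 2 1
        - 4 / of_real pi ^ 2 * legendre_chi 3 1 - 2 * (1 / 2)\<^sup>2)) (at_right 0)"
    by (intro tendsto_mult tendsto_add tendsto_diff tendsto_exp tendsto_const tendsto_power tendsto_of_real
        R1 T ln_tanh_pi_limits ln_tanh_pi_limit_exp legendre_chi_tendsto_1) auto
  also have "(of_real pi * exp Z * exp (1 / 2) * \<Gamma> 3 (3 / 2) ^ 16) * (\<i> * of_real (- 1))
      * exp (- 4 * \<i> * of_real 0 + 4 * of_real 0)
      * exp (8 * \<i> / of_real pi * (1 / 2) * legendre_chi 2 1
        - 4 / of_real pi ^ 2 * legendre_chi 3 1 - 2 * (1 / 2)\<^sup>2) =
      of_real pi * exp Z * \<Gamma> 3 (3 / 2) ^ 16 * (- \<i>) * exp (4 * \<i> / of_real pi * legendre_chi 2 1 - Z)"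
  proof -
    have "8 * \<i> / of_real pi * (1 / 2) * legendre_chi 2 1 - 4 / of_real pi ^ 2 * legendre_chi 3 1 - 2 * (1 / 2)\<^sup>2
       = (4 * \<i> / of_real pi * legendre_chi 2 1 - Z) - 1 / 2"
      by (simp add: legendre_chi_3_1 Z_def power2_eq_square)
    thus ?thesis by (simp only: exp_diff) simp
  qed
  finally have lim: "((\<lambda>e. R1 (T e) * (\<i> * of_real ((exp (- (pi * e)) - exp (pi * e)) / 2 * exp (- ln_tanh_pi e)))
      * exp (- 4 * \<i> * of_real (e * ln_tanh_pi e) + 4 * of_real (e\<^sup>2 * ln_tanh_pi e))
      * exp (8 * \<i> / of_real pi * T e * legendre_chi 2 (of_real (exp (- 2 * pi * e)))
        - 4 / of_real pi ^ 2 * legendre_chi 3 (of_real (exp (- 2 * pi * e))) - 2 * (T e)\<^sup>2)) \<longlongrightarrow>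
      of_real pi * exp Z * \<Gamma> 3 (3 / 2) ^ 16 * (- \<i>) * exp (4 * \<i> / of_real pi * legendre_chi 2 1 - Z)) (at_right 0)" .
  have "((\<lambda>e. rhs_product \<Gamma> (T e) * exp (Phi (T e) - 2 * (T e)\<^sup>2)) \<longlongrightarrow>
      of_real pi * exp Z * \<Gamma> 3 (3 / 2) ^ 16 * (- \<i>) * exp (4 * \<i> / of_real pi * legendre_chi 2 1 - Z)) (at_right 0)"
    by (rule tendsto_cong[THEN iffD2, OF _ lim], rule eventually_mono[OF eventually_at_right_less[of 0]]) (rule main)
  thus ?thesis unfolding T_def .
qed

text \<open>The constant of \<open>rhs_product_upper_const\<close> is computed from both limits.
  With c = \<Gamma>_3 (3/2) and z the exponent involving zeta (3), its modulus is exp (2 z) / (pi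
  c^16) by the limit at 0 and pi c^16 by the limit at 1/2. So pi c^16 = exp z, which makes the value
  at 0 equal to 1.\<close>

lemma rhs_product_0:
  assumes fam: "multiple_Gamma_family \<Gamma>"
  shows "rhs_product \<Gamma> 0 = 1"
proof -
  define c where "c = Re (\<Gamma> 3 (3 / 2))"
  have c: "\<Gamma> 3 (3 / 2) = of_real c" "c > 0"
    using multiple_Gamma_pos[OF fam, of 3 "3/2"] by (auto simp: c_def)
  define z where "z = 7 * Re (zeta 3) / (2 * pi ^ 2)"
  have z: "7 * zeta 3 / (2 * of_real pi ^ 2) = of_real z"
    unfolding z_def by (subst zeta_3_real) simp
  have R0: "rhs_product \<Gamma> 0 = of_real (exp z / (pi * c ^ 16))"
  proof -
    have "\<Gamma> 2 1 = 1" "\<Gamma> 3 1 = 1" using multiple_Gamma_1[OF fam, of 2] multiple_Gamma_1[OF fam, of 3] by auto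
    thus ?thesis using c
      by (simp add: rhs_product_def z Barnes_G_def exp_of_real power_divide power_mult_distrib flip: power_add)
  qed
  \<comment> \<open>The phase of the limit at \<open>1/2\<close> is of no interest: comparing moduli determines \<open>c > 0\<close>.\<close>
  define K where "K = rhs_product \<Gamma> \<i> * exp (Phi \<i> - 2 * \<i>\<^sup>2)"
  have ev: "\<forall>\<^sub>F e in at_right 0. rhs_product \<Gamma> (a + \<i> * of_real e) * exp (Phi (a + \<i> * of_real e) - 2 * (a + \<i> * of_real e)\<^sup>2) = K"
    if "Im a = 0" for a
    using eventually_at_right_less[of "0::real"]
  proof eventually_elim
    case (elim e)
    show ?case unfolding K_def by (rule rhs_product_upper_const[OF fam]) (use that elim in auto)
  qed
  have "((\<lambda>e. K) \<longlongrightarrow> rhs_product \<Gamma> 0 * exp (of_real z)) (at_right (0::real))"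
    using rhs_product_Phi_tendsto_0[OF fam] tendsto_cong[OF ev[of 0]] by (simp add: z)
  hence K1: "K = rhs_product \<Gamma> 0 * exp (of_real z)" by (simp add: tendsto_const_iff)
  have "((\<lambda>e. K) \<longlongrightarrow> of_real pi * exp (of_real z) * of_real c ^ 16 * (- \<i>) * exp (4 * \<i> / of_real pi * legendre_chi 2 1 - of_real z)) (at_right (0::real))"
    using rhs_product_Phi_tendsto_half[OF fam] tendsto_cong[OF ev[of "1/2"]] by (simp add: z c)
  hence K2: "K = of_real pi * exp (of_real z) * of_real c ^ 16 * (- \<i>) * exp (4 * \<i> / of_real pi * legendre_chi 2 1 - of_real z)"
    by (simp add: tendsto_const_iff)
  have "norm K = exp z / (pi * c ^ 16) * exp z" unfolding K1 R0 using c by (simp add: norm_mult norm_divide norm_power)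
  moreover have "norm K = pi * c ^ 16"
    unfolding K2 using c Im_legendre_chi_1[of 2]
    by (simp add: norm_mult norm_power exp_diff norm_divide)
  ultimately have "(exp z)\<^sup>2 = (pi * c ^ 16)\<^sup>2" using c by (simp add: field_simps power2_eq_square)
  hence "exp z = pi * c ^ 16" using c by (simp add: power2_eq_iff_nonneg)
  thus ?thesis using R0 c by simp
qed

theorem proposition6:
  fixes \<Gamma> :: "nat \<Rightarrow> complex \<Rightarrow> complex" and x :: complex
  assumes "multiple_Gamma_family \<Gamma>"
    and "Re x > - 1 / 2"
  shows "(\<lambda>N. \<Prod>k=1..2*N. (1 - 4 * x ^ 2 / of_nat k ^ 2) powi (- (int k ^ 2) * (-1) ^ k)) \<longlonglongrightarrow>
      cos (of_real pi * x) / of_real pi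
      * exp (2 * x ^ 2 + 7 * zeta 3 / (2 * of_real pi ^ 2))
      * (Barnes_G \<Gamma> (1 + x) * Barnes_G \<Gamma> (1 - x)) ^ 4
      * ((\<Gamma> 3 (1 - x) * \<Gamma> 3 (1 + x)) / (\<Gamma> 3 (3 / 2 - x) * \<Gamma> 3 (3 / 2 + x))) ^ 8"
proof -
  have "(\<lambda>N. lhs_product N x) \<longlonglongrightarrow> rhs_product \<Gamma> x"
  proof (cases "x \<in> half_Int_Compl")
    case True
    thus ?thesis using lhs_product_tendsto[OF assms(1)] rhs_product_0[OF assms(1)] by simp
  next
    case False
    \<comment> \<open>At the excluded points, which here are x = k/2 with k > 0, both sides evaluate
      to 0. For odd k this is a true zero; for even k it is the default value at a pole.\<close>
    then obtain n where n: "2 * x = of_int n" "x \<noteq> 0" by (auto simp: half_Int_Compl_def elim: Ints_cases)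
    have "2 * Re x = of_int n" using arg_cong[OF n(1), of Re] by simp
    hence "n > -1" using assms(2) by linarith
    moreover have "n \<noteq> 0" using n by auto
    ultimately have "n > 0" by simp
    define k where "k = nat n"
    have k: "2 * x = of_nat k" "k > 0" using n \<open>n > 0\<close> by (simp_all add: k_def)
    \<comment> \<open>The base is 0 and the exponent is nonzero. For even k the exponent is
      negative, and \<open>powi\<close> still gives 0 because \<open>inverse 0 = 0\<close>.\<close>
    have fac: "(1 - 4 * x ^ 2 / of_nat k ^ 2) powi (- (int k ^ 2) * (-1) ^ k) = 0"
    proof -
      have "4 * x ^ 2 = of_nat k ^ 2" unfolding k(1)[symmetric] by (simp add: power_mult_distrib)
      thus ?thesis using k(2) by simp
    qed
    have L: "lhs_product N x = 0" if "N \<ge> k" for N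
      unfolding lhs_product_def by (rule prod_zero[OF _ bexI[of _ k]]) (use fac k that in auto)
    \<comment> \<open>For integer x the value of \<Gamma>_2 at its pole 1 - x is 0 by convention, so
      \<open>Barnes_G\<close> is 1 / 0 = 0 there. Otherwise the cosine vanishes.\<close>
    have R: "rhs_product \<Gamma> x = 0"
    proof (cases "even k")
      case True
      then obtain m where "k = 2 * m" by blast
      hence "x = of_nat m" "m > 0" using k by auto
      hence "1 - x = - of_nat (m - 1)" by (simp add: of_nat_diff)
      hence "\<Gamma> 2 (1 - x) = 0" using multiple_Gamma_nonpos_Int[OF assms(1), of 2 "1 - x"] by simp
      thus ?thesis by (simp add: rhs_product_def Barnes_G_def)
    next
      case False
      then obtain m where "k = 2 * m + 1" by (elim oddE)
      hence "x = of_nat m + 1 / 2" using k by (simp add: field_simps)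
      hence "of_real pi * x = of_real (of_int (int m) * pi) + of_real pi / 2" by (simp add: algebra_simps)
      hence "cos (of_real pi * x) = 0" unfolding cos_eq_0 by blast
      thus ?thesis by (simp add: rhs_product_def)
    qed
    show ?thesis unfolding R
      by (rule tendsto_eventually) (use L in \<open>auto simp: eventually_sequentially\<close>)
  qed
  thus ?thesis unfolding lhs_product_def rhs_product_def .
qed

end
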